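(* The map $X\mapsto \omega(X)$ establishes an isomorphism between the lattice $(\mathcal{S},\prec_F)$ of stable matchings and the lattice $(\mathcal{I},\subset)$ of ideals of the poset of rotations $(\mathcal{R},\lessdot)$ (where the greatest lower and least upper bounds of $I,I'\in\mathcal{I}$ are $I\cap I'$ and $I\cup I'$, respectively).
   Context: Setting. $G=(V,E)$ is a finite bipartite graph without multiple edges, with vertex parts $W$ and $F$; the edge joining $w\in W$ and $f\in F$ is denoted $wf$. $E_v$ is the set of edges incident to $v\in V$, and $X_v:=X\cap E_v$ for $X\subseteq E$. Each $w\in W$ has a strict linear order $>_w$ on $E_w$ ($e>_w e'$ means that $e$ is preferred to $e'$) and quota $q(w)=1$; accordingly $C_w(Z)$, for nonempty $Z\subseteq E_w$, is the one-element set formed by the $>_w$-largest element of $Z$, and $C_w(\emptyset)=\emptyset$. Each $f\in F$ has a choice function $C_f:2^{E_f}\to 2^{E_f}$ with $C_f(Z)\subseteq Z$, satisfying for all $Z,Z'\subseteq E_f$: (A1) if $Z\supseteq Z'\supseteq C_f(Z)$ then $C_f(Z')=C_f(Z)$; (A2) if $Z\supseteq Z'$ then $C_f(Z)\cap Z'\subseteq C_f(Z')$; (A3) if $Z\supseteq Z'$ then $|C_f(Z)|\ge |C_f(Z')|$. Stability. A matching is an arbitrary subset $X\subseteq E$. A set $Z\subseteq E_v$ is acceptable if $C_v(Z)=Z$; $X\subseteq E$ is acceptable if all $X_v$, $v\in V$, are. For acceptable $Z,Z'\subseteq E_v$, $Z\succeq_v Z'$ means $C_v(Z\cup Z')=Z$.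 For distinct acceptable matchings $X,Y$, $X\succ_F Y$ (also written $X\succ Y$, or $Y\prec X$) means $X_f\succeq_f Y_f$ for all $f\in F$. An acceptable $X$ is stable if there is no edge $e=wf\in E\setminus X$ with both $e\in C_w(X_w\cup\{e\})$ and $e\in C_f(X_f\cup\{e\})$. $\mathcal{S}$ is the set of stable matchings. It is known that $\mathcal{S}\neq\emptyset$ and $(\mathcal{S},\prec_F)$ is a distributive lattice; its minimal and maximal elements are denoted $X^{\min}$, $X^{\max}$. Active graph and rotations. Let $X\in\mathcal{S}$. For $w\in W$ with $|X_w|=1$, let $x_w$ be the unique edge of $X_w$. If the set of edges $e=wf\in E_w$ with $x_w>_w e$ and $e\in C_f(X_f\cup\{e\})$ is nonempty, its $>_w$-largest element is called $W$-admissible and denoted $a_w$. If $a_w=wf$ and $C_f(X_f\cup\{a_w\})=(X_f\setminus\{e'\})\cup\{a_w\}$ for some $e'\in X_f$, then $e'$ is called $F$-admissible, is denoted $b^w_f$ and said to be associated with $a_w$, and $(a_w,b^w_f)$ is called a tandem passing $f$ (the only other possibility is $C_f(X_f\cup\{a_w\})=X_f\cup\{a_w\}$, when $a_w$ generates no tandem). Let $D(X)$ be the directed graph on $V$ whose edges are the $W$-admissible edges directed from $W$ to $F$ and the $F$-admissible edges directed from $F$ to $W$. Cleaning procedure: as long as the current graph has a vertex $w\in W$ with a leaving edge $a_w=(w,f)$ but no entering edge, delete $a_w$, and if $a_w$ has an associated edge $b^w_f$ which occurs in no other tandem passing $f$ in the current graph, delete $b^w_f$ as well; isolated vertices are removed.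 The final graph $\Gamma(X)$ is the active graph of $X$. In it every $w\in W$ that remains has exactly one entering and one leaving edge, and for every remaining $f\in F$ the tandems passing $f$ partition the set of edges at $f$. Hence $\Gamma(X)$ decomposes uniquely into pairwise edge-disjoint directed cycles (edge-simple, possibly visiting a vertex of $F$ several times) which at each $w\in W$ go from the entering to the leaving edge, and at each visit to $f\in F$ traverse a tandem ($a_w$, then $b^w_f$). These cycles are the rotations generated by $X$; their set is $\mathcal{L}(X)$. For a rotation $L$, $L^+$ is the set of its edges going from $W$ to $F$ and $L^-$ the set of its edges going from $F$ to $W$ (both regarded as subsets of $E$); a rotation is identified by the pair $(L^+,L^-)$. Applying $L\in\mathcal{L}(X)$ to $X$ gives $(X\setminus L^-)\cup L^+$, which is again a stable matching. Poset of rotations. A route from $X_0$ to $X_N$ ($N\ge 0$) is a sequence $X_0,X_1,\ldots,X_N$ with $X_0$ stable and $X_i=(X_{i-1}\setminus L_i^-)\cup L_i^+$ for some $L_i\in\mathcal{L}(X_{i-1})$; its set of rotations is $\{L_1,\ldots,L_N\}$. A full route is one from $X^{\min}$ to $X^{\max}$. All full routes have the same set of rotations, denoted $\mathcal{R}$. For $R,R'\in\mathcal{R}$, $R\lessdot R'$ means that in every full route $R$ is applied earlier than $R'$; this is a partial order. An ideal of $(\mathcal{R},\lessdot)$ is a subset $I\subseteq\mathcal{R}$ such that $R\lessdot R'$ and $R'\in I$ imply $R\in I$; $\mathcal{I}$ is the set of ideals. For $X\in\mathcal{S}$, $\omega(X)$ denotes the set of rotations of a route from $X^{\min}$ to $X$;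 such a route exists, the set depends only on $X$, and it is an ideal of $(\mathcal{R},\lessdot)$. *)

theory Defs
  imports "HOL-Algebra.Lattice"
begin

text \<open>
  The two vertex parts live in two different types, so an edge \<open>wf\<close> is the pair \<open>(w, f)\<close>;
  \<open>pref w\<close> is the relation \<open>>\<^sub>w\<close>, i.e. \<open>(e, e') \<in> pref w\<close> says that \<open>w\<close> prefers \<open>e\<close> to \<open>e'\<close>.
\<close>

locale choice_market =
  fixes W :: "'w set" and F :: "'f set" and E :: "('w \<times> 'f) set"
    and pref :: "'w \<Rightarrow> (('w \<times> 'f) \<times> ('w \<times> 'f)) set"
    and CF :: "'f \<Rightarrow> ('w \<times> 'f) set \<Rightarrow> ('w \<times> 'f) set"
  assumes finite_W: "finite W" and finite_F: "finite F" and edges: "E \<subseteq> W \<times> F"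
    and pref_field: "w \<in> W \<Longrightarrow> pref w \<subseteq> {e \<in> E. fst e = w} \<times> {e \<in> E. fst e = w}"
    and pref_linear: "w \<in> W \<Longrightarrow> strict_linear_order_on {e \<in> E. fst e = w} (pref w)"
    and CF_subset: "f \<in> F \<Longrightarrow> Z \<subseteq> {e \<in> E. snd e = f} \<Longrightarrow> CF f Z \<subseteq> Z"
    and CF_consistent: "f \<in> F \<Longrightarrow> Z \<subseteq> {e \<in> E. snd e = f} \<Longrightarrow> Z' \<subseteq> Z \<Longrightarrow> CF f Z \<subseteq> Z'
      \<Longrightarrow> CF f Z' = CF f Z"
    and CF_substitutable: "f \<in> F \<Longrightarrow> Z \<subseteq> {e \<in> E. snd e = f} \<Longrightarrow> Z' \<subseteq> Z
      \<Longrightarrow> CF f Z \<inter> Z' \<subseteq> CF f Z'"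
    and CF_card_mono: "f \<in> F \<Longrightarrow> Z \<subseteq> {e \<in> E. snd e = f} \<Longrightarrow> Z' \<subseteq> Z
      \<Longrightarrow> card (CF f Z') \<le> card (CF f Z)"
begin

definition at_W :: "('w \<times> 'f) set \<Rightarrow> 'w \<Rightarrow> ('w \<times> 'f) set" where
  "at_W X w = {e \<in> X. e \<in> E \<and> fst e = w}"

definition at_F :: "('w \<times> 'f) set \<Rightarrow> 'f \<Rightarrow> ('w \<times> 'f) set" where
  "at_F X f = {e \<in> X. e \<in> E \<and> snd e = f}"

definition CW :: "'w \<Rightarrow> ('w \<times> 'f) set \<Rightarrow> ('w \<times> 'f) set" where
  "CW w Z = {e \<in> Z. \<forall>e' \<in> Z - {e}. (e, e') \<in> pref w}"

definition acceptable :: "('w \<times> 'f) set \<Rightarrow> bool" where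
  "acceptable X \<longleftrightarrow> X \<subseteq> E \<and> (\<forall>w\<in>W. CW w (at_W X w) = at_W X w)
     \<and> (\<forall>f\<in>F. CF f (at_F X f) = at_F X f)"

definition stable :: "('w \<times> 'f) set \<Rightarrow> bool" where
  "stable X \<longleftrightarrow> acceptable X \<and>
     \<not> (\<exists>w f. (w, f) \<in> E - X \<and> (w, f) \<in> CW w (at_W X w \<union> {(w, f)})
            \<and> (w, f) \<in> CF f (at_F X f \<union> {(w, f)}))"

definition prefers_F :: "('w \<times> 'f) set \<Rightarrow> ('w \<times> 'f) set \<Rightarrow> bool" where
  "prefers_F X Y \<longleftrightarrow> acceptable X \<and> acceptable Y \<and> X \<noteq> Y
     \<and> (\<forall>f\<in>F. CF f (at_F X f \<union> at_F Y f) = at_F X f)"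

definition stable_lattice :: "('w \<times> 'f) set gorder" where
  "stable_lattice = \<lparr>carrier = {X. stable X}, eq = (=), le = (\<lambda>X Y. X = Y \<or> prefers_F Y X)\<rparr>"

definition X_min :: "('w \<times> 'f) set" where
  "X_min = bottom stable_lattice"

definition X_max :: "('w \<times> 'f) set" where
  "X_max = top stable_lattice"

definition W_candidates :: "('w \<times> 'f) set \<Rightarrow> 'w \<Rightarrow> ('w \<times> 'f) set" where
  "W_candidates X w = {e \<in> E. fst e = w \<and> (\<exists>x. at_W X w = {x} \<and> (x, e) \<in> pref w)
     \<and> e \<in> CF (snd e) (at_F X (snd e) \<union> {e})}"

definition W_admissible :: "('w \<times> 'f) set \<Rightarrow> ('w \<times> 'f) set" where
  "W_admissible X = (\<Union>w\<in>W. CW w (W_candidates X w))"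

definition tandems :: "('w \<times> 'f) set \<Rightarrow> (('w \<times> 'f) \<times> ('w \<times> 'f)) set" where
  "tandems X = {(a, b). a \<in> W_admissible X \<and> b \<in> at_F X (snd a)
     \<and> CF (snd a) (at_F X (snd a) \<union> {a}) = (at_F X (snd a) - {b}) \<union> {a}}"

definition F_admissible :: "('w \<times> 'f) set \<Rightarrow> ('w \<times> 'f) set" where
  "F_admissible X = snd ` tandems X"

text \<open>
  Since isolated vertices are discarded, a subgraph of \<open>D(X)\<close> is given by its edges: a pair
  \<open>(A, B)\<close> of the set \<open>A\<close> of edges directed from \<open>W\<close> to \<open>F\<close> and the set \<open>B\<close> of edges directed
  from \<open>F\<close> to \<open>W\<close>. One cleaning step deletes the edge \<open>a\<close> leaving a vertex \<open>fst a\<close> that has no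
  entering edge, together with the edge associated with \<open>a\<close> (if any) unless the latter belongs to
  another tandem of the current graph.
\<close>

inductive cleaning_step ::
  "('w \<times> 'f) set \<Rightarrow> ('w \<times> 'f) set \<times> ('w \<times> 'f) set \<Rightarrow> ('w \<times> 'f) set \<times> ('w \<times> 'f) set \<Rightarrow> bool"
  for X where
  "a \<in> A \<Longrightarrow> \<not> (\<exists>b\<in>B. fst b = fst a) \<Longrightarrow>
   cleaning_step X (A, B)
     (A - {a},
      B - {b. (a, b) \<in> tandems X \<and> \<not> (\<exists>a'\<in>A. a' \<noteq> a \<and> (a', b) \<in> tandems X)})"

text \<open>The order in which edges are cleaned does not matter, so the final graph is unique.\<close>

definition active_graph :: "('w \<times> 'f) set \<Rightarrow> ('w \<times> 'f) set \<times> ('w \<times> 'f) set" where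
  "active_graph X = (THE G. (cleaning_step X)\<^sup>*\<^sup>* (W_admissible X, F_admissible X) G
     \<and> \<not> (\<exists>G'. cleaning_step X G G'))"

text \<open>
  A cycle of the decomposition of \<open>\<Gamma>(X)\<close> is the list \<open>[(a\<^sub>0, b\<^sub>0), \<dots>, (a\<^sub>k\<^sub>-\<^sub>1, b\<^sub>k\<^sub>-\<^sub>1)]\<close> of the
  tandems it traverses: at \<open>F\<close> it goes from \<open>a\<^sub>i\<close> to \<open>b\<^sub>i\<close>, and the end of \<open>b\<^sub>i\<close> in \<open>W\<close> is the end
  in \<open>W\<close> of \<open>a\<^sub>i\<^sub>+\<^sub>1\<close>, indices modulo \<open>k\<close>. No edge is repeated, but a vertex in \<open>F\<close> may be.
\<close>

definition rotation_cycle :: "('w \<times> 'f) set \<Rightarrow> (('w \<times> 'f) \<times> ('w \<times> 'f)) list \<Rightarrow> bool" where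
  "rotation_cycle X ts \<longleftrightarrow> ts \<noteq> []
     \<and> (\<forall>(a, b) \<in> set ts. (a, b) \<in> tandems X
           \<and> a \<in> fst (active_graph X) \<and> b \<in> snd (active_graph X))
     \<and> distinct (map fst ts) \<and> distinct (map snd ts)
     \<and> (\<forall>i < length ts. fst (snd (ts ! i)) = fst (fst (ts ! (Suc i mod length ts))))"

text \<open>A rotation \<open>L\<close> is represented by \<open>(L\<^sup>+, L\<^sup>-)\<close>.\<close>

definition rotations_of :: "('w \<times> 'f) set \<Rightarrow> (('w \<times> 'f) set \<times> ('w \<times> 'f) set) set" where
  "rotations_of X = {(fst ` set ts, snd ` set ts) | ts. rotation_cycle X ts}"

definition apply_rotation ::
  "('w \<times> 'f) set \<times> ('w \<times> 'f) set \<Rightarrow> ('w \<times> 'f) set \<Rightarrow> ('w \<times> 'f) set" where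
  "apply_rotation L X = (X - snd L) \<union> fst L"

text \<open>\<open>route X Ls Y\<close>: applying successively the rotations in the list \<open>Ls\<close> leads from \<open>X\<close> to \<open>Y\<close>.\<close>

inductive route ::
  "('w \<times> 'f) set \<Rightarrow> (('w \<times> 'f) set \<times> ('w \<times> 'f) set) list \<Rightarrow> ('w \<times> 'f) set \<Rightarrow> bool"
  for X where
  start: "stable X \<Longrightarrow> route X [] X"
| extend: "route X Ls Y \<Longrightarrow> L \<in> rotations_of Y \<Longrightarrow> route X (Ls @ [L]) (apply_rotation L Y)"

definition all_rotations :: "(('w \<times> 'f) set \<times> ('w \<times> 'f) set) set" where
  "all_rotations = (THE R. \<exists>Ls. route X_min Ls X_max \<and> R = set Ls)"

definition rot_less ::
  "('w \<times> 'f) set \<times> ('w \<times> 'f) set \<Rightarrow> ('w \<times> 'f) set \<times> ('w \<times> 'f) set \<Rightarrow> bool" where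
  "rot_less R R' \<longleftrightarrow> R \<in> all_rotations \<and> R' \<in> all_rotations \<and>
     (\<forall>Ls. route X_min Ls X_max \<longrightarrow>
        (\<forall>i < length Ls. \<forall>j < length Ls. Ls ! i = R \<and> Ls ! j = R' \<longrightarrow> i < j))"

definition rotation_ideals :: "(('w \<times> 'f) set \<times> ('w \<times> 'f) set) set set" where
  "rotation_ideals = {I. I \<subseteq> all_rotations \<and> (\<forall>R R'. rot_less R R' \<and> R' \<in> I \<longrightarrow> R \<in> I)}"

definition ideal_lattice :: "(('w \<times> 'f) set \<times> ('w \<times> 'f) set) set gorder" where
  "ideal_lattice = \<lparr>carrier = rotation_ideals, eq = (=), le = (\<subseteq>)\<rparr>"

definition omega :: "('w \<times> 'f) set \<Rightarrow> (('w \<times> 'f) set \<times> ('w \<times> 'f) set) set" where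
  "omega X = (THE I. \<exists>Ls. route X_min Ls X \<and> I = set Ls)"

end

definition lattice_isomorphism :: "'a gorder \<Rightarrow> 'b gorder \<Rightarrow> ('a \<Rightarrow> 'b) \<Rightarrow> bool" where
  "lattice_isomorphism L M h \<longleftrightarrow> lattice L \<and> lattice M \<and> bij_betw h (carrier L) (carrier M)
     \<and> order_emb L M h \<and> meet_pres L M h \<and> join_pres L M h"

end

theory Submission
  imports Defs
begin

text \<open>
  The choice functions \<open>C\<^sub>f\<close> act on disjoint sets of edges, so together they form one choice
  function on \<open>E\<close> with the same three properties. For a set \<open>X\<close> of edges let its \<^emph>\<open>menu\<close> consist of
  the edges that their end in \<open>W\<close> does not rank below an edge of \<open>X\<close>; it is what \<open>F\<close> can choose
  from when every \<open>w\<close> offers its edges in descending order down to its edge in \<open>X\<close>. Then \<open>X\<close> is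
  stable exactly if the choice from the menu of \<open>X\<close> is \<open>X\<close> (\<open>stable_iff_settled\<close>), and \<open>\<prec>\<^sub>F\<close> becomes
  inclusion of menus (\<open>prefers_F_iff\<close>). By substitutability together with a counting argument
  based on cardinal monotonicity, the union and the intersection of two menus of stable matchings
  are again such menus (\<open>settled_join\<close>, \<open>settled_meet\<close>). Thus \<open>\<S>\<close> is a ring of sets.

  In a finite ring of sets a covering step \<open>X\<close>, \<open>Y\<close> adds to the menu a \<^emph>\<open>block\<close>, and for every member
  \<open>Z\<close> of the ring the block is contained in the menu of \<open>Z\<close> or disjoint from it, since otherwise
  the menu of \<open>X \<or> (Y \<and> Z)\<close> would lie strictly between those of \<open>X\<close> and \<open>Y\<close>
  (\<open>cover_block_dichotomy\<close>). So two blocks are equal or disjoint, and a stable matching is determined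
  by the blocks inside its menu, that is, by the blocks added on any chain of covering steps leading
  to it from the minimum. This is the idea of Birkhoff's representation theorem, and it shows at
  once that all routes to \<open>X\<close> use the same rotations.

  It remains to see that rotations are labels of covering steps: \<open>Y\<close> covers \<open>X\<close> iff it arises from \<open>X\<close>
  by a rotation (\<open>rotations_of_eq\<close>), and the pair \<open>(Y - X, X - Y)\<close> and the block determine each other
  (\<open>block_step_label\<close>, \<open>step_label_determined\<close>). For the former, a cycle of tandems produces a stable
  matching by substitutability and a count (\<open>settled_after_cycle\<close>); if \<open>Y\<close> is stable and above \<open>X\<close>,
  following tandems from an edge of \<open>X - Y\<close> never leaves \<open>X - Y\<close> and hence closes a cycle whose
  application stays below \<open>Y\<close> (\<open>tandem_cycle_below\<close>); and two cycles that meet coincide. Cleaning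
  never destroys a cycle of tandems (\<open>rotation_cycle_iff\<close>).

  Finally, for a rotation \<open>L\<close> there is a least stable matching \<open>M\<close> whose menu contains the block of
  \<open>L\<close>. Every other rotation in \<open>\<omega>(M)\<close> precedes \<open>L\<close> in all full routes, so an ideal is the union of
  the sets \<open>\<omega>(M)\<close> over its elements \<open>L\<close>, and such unions are realised by joins (\<open>ideal_is_passed\<close>).
\<close>

section \<open>Stable matchings as fixed points of choosing from the menu\<close>

text \<open>
  The market seen from the edges: every agent, that is, every vertex of \<open>W\<close>, ranks its own edges,
  and the whole side \<open>F\<close> acts as one chooser among all edges. Stable matchings, their lattice and
  their rotations can all be expressed in these terms.
\<close>
locale ranked_choice =
  fixes E :: "'e set" and agent :: "'e \<Rightarrow> 'w"
    and beats :: "'e \<Rightarrow> 'e \<Rightarrow> bool" and chosen :: "'e set \<Rightarrow> 'e set"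
  assumes finite_E: "finite E"
    and beats_mem: "beats e e' \<Longrightarrow> e \<in> E \<and> e' \<in> E \<and> agent e' = agent e"
    and beats_irrefl: "\<not> beats e e"
    and beats_trans: "beats e e' \<Longrightarrow> beats e' e'' \<Longrightarrow> beats e e''"
    and beats_total: "e \<in> E \<Longrightarrow> e' \<in> E \<Longrightarrow> agent e = agent e' \<Longrightarrow> e \<noteq> e' \<Longrightarrow> beats e e' \<or> beats e' e"
    and chosen_subset: "chosen Z \<subseteq> Z \<inter> E"
    and chosen_consistent: "chosen Z \<subseteq> Z' \<Longrightarrow> Z' \<subseteq> Z \<Longrightarrow> chosen Z' = chosen Z"
    and chosen_substitutable: "e \<in> chosen Z \<Longrightarrow> Z' \<subseteq> Z \<Longrightarrow> e \<in> Z' \<Longrightarrow> e \<in> chosen Z'"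
    and card_chosen_mono: "Z' \<subseteq> Z \<Longrightarrow> card (chosen Z') \<le> card (chosen Z)"
begin

lemma beats_asym: "beats e e' \<Longrightarrow> \<not> beats e' e"
  using beats_trans beats_irrefl by blast

lemma best_exists:
  assumes "Z \<subseteq> E" "Z \<noteq> {}" "\<And>e. e \<in> Z \<Longrightarrow> agent e = w"
  obtains m where "m \<in> Z" "\<And>e. e \<in> Z \<Longrightarrow> e \<noteq> m \<Longrightarrow> beats m e"
proof -
  have "finite Z" using assms(1) finite_E finite_subset by blast
  from this assms(2,1,3) have "\<exists>m\<in>Z. \<forall>e\<in>Z. e \<noteq> m \<longrightarrow> beats m e"
  proof (induction Z rule: finite_ne_induct)
    case (singleton x)
    then show ?case by simp
  next
    case (insert x Z)
    then obtain m where m: "m \<in> Z" "\<forall>e\<in>Z. e \<noteq> m \<longrightarrow> beats m e" by auto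
    from m(1) insert have "x \<noteq> m" "x \<in> E" "m \<in> E" "agent x = agent m" by auto
    then have "beats x m \<or> beats m x" using beats_total by blast
    then show ?case
    proof
      assume "beats x m"
      then have "\<forall>e\<in>insert x Z. e \<noteq> x \<longrightarrow> beats x e"
        using m beats_trans by (metis insertE)
      then show ?thesis by blast
    next
      assume "beats m x"
      then show ?thesis using m by blast
    qed
  qed
  then show thesis using that by blast
qed

definition menu :: "'e set \<Rightarrow> 'e set" where
  "menu X = {e \<in> E. \<forall>x\<in>X. \<not> beats x e}"

text \<open>
  These sets turn out to be the stable matchings. The equation already forces at most one edge per
  agent, because a second, lower edge of the same agent would not be on the menu.
\<close>
definition settled :: "'e set \<Rightarrow> bool" where
  "settled X \<longleftrightarrow> chosen (menu X) = X"

lemma menu_E: "menu X \<subseteq> E"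
  by (auto simp: menu_def)

lemma menu_upward: "e \<in> menu X \<Longrightarrow> beats e' e \<Longrightarrow> e' \<in> menu X"
  unfolding menu_def using beats_trans beats_mem by blast

lemma not_menuE:
  assumes "e \<in> E" "e \<notin> menu X"
  obtains x where "x \<in> X" "beats x e"
  using assms by (auto simp: menu_def)

lemma
  assumes "settled X"
  shows settled_chosen_menu: "chosen (menu X) = X"
    and settled_menu: "X \<subseteq> menu X"
    and settled_E: "X \<subseteq> E"
  using assms chosen_subset[of "menu X"] by (auto simp: settled_def)

lemma settled_between:
  assumes "settled X" "X \<subseteq> Z" "Z \<subseteq> menu X"
  shows "chosen Z = X"
  using chosen_consistent[of "menu X" Z] assms by (simp add: settled_def)

lemma settled_fixed: "settled X \<Longrightarrow> chosen X = X"
  using settled_between settled_menu by blast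

lemma settled_unique:
  assumes "settled X" "x \<in> X" "y \<in> X" "agent x = agent y"
  shows "x = y"
  using settled_menu[OF assms(1)] assms(2-) beats_total[of x y] by (auto simp: menu_def)

lemma settled_card: "settled X \<Longrightarrow> card X = card (agent ` X)"
  by (metis card_image inj_onI settled_unique)

lemma menu_inj: "settled X \<Longrightarrow> settled Y \<Longrightarrow> menu X = menu Y \<Longrightarrow> X = Y"
  by (metis settled_def)

lemma mem_menu_iff:
  assumes "settled X" "x \<in> X" "e \<in> E" "agent e = agent x"
  shows "e \<in> menu X \<longleftrightarrow> e = x \<or> beats e x"
proof
  assume "e \<in> menu X"
  then show "e = x \<or> beats e x"
    using assms beats_total[of e x] settled_E[OF assms(1)] by (auto simp: menu_def)
next
  assume "e = x \<or> beats e x"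
  then show "e \<in> menu X"
    using assms(1,2) settled_menu menu_upward by blast
qed

text \<open>
  Deferred acceptance as a least fixed point: an edge is proposed once all edges that its agent
  prefers have been proposed and rejected. By substitutability rejections only grow with the set of
  proposals, so the operator is monotone.
\<close>
lemma settled_exists: "\<exists>X. settled X"
proof -
  define \<Phi> where "\<Phi> U = {e \<in> E. \<forall>e'. beats e' e \<longrightarrow> e' \<in> U - chosen U}" for U
  have "mono \<Phi>"
  proof (rule monoI)
    fix U V :: "'e set" assume "U \<subseteq> V"
    then show "\<Phi> U \<subseteq> \<Phi> V"
      unfolding \<Phi>_def using chosen_substitutable by blast
  qed
  define U where "U = lfp \<Phi>"
  have U: "U = \<Phi> U" unfolding U_def by (rule lfp_unfold[OF \<open>mono \<Phi>\<close>])
  have UE: "U \<subseteq> E" by (subst U) (auto simp: \<Phi>_def)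
  have "menu (chosen U) = U"
  proof (rule Set.set_eqI)
    fix e
    show "e \<in> menu (chosen U) \<longleftrightarrow> e \<in> U"
    proof
      assume e: "e \<in> menu (chosen U)"
      show "e \<in> U"
      proof (rule ccontr)
        assume "e \<notin> U"
        define Z where "Z = {d \<in> E. agent d = agent e \<and> d \<notin> U}"
        have "e \<in> Z" using e \<open>e \<notin> U\<close> menu_E by (auto simp: Z_def)
        \<comment> \<open>The best edge of the agent that was never proposed would have been proposed next.\<close>
        have "Z \<subseteq> E" "Z \<noteq> {}" "\<And>d. d \<in> Z \<Longrightarrow> agent d = agent e"
          using \<open>e \<in> Z\<close> by (auto simp: Z_def)
        from best_exists[OF this]
        obtain m where m: "m \<in> Z" "\<And>d. d \<in> Z \<Longrightarrow> d \<noteq> m \<Longrightarrow> beats m d" by metis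
        have "m \<in> \<Phi> U"
          unfolding \<Phi>_def
        proof (intro CollectI conjI allI impI)
          show "m \<in> E" using m(1) by (simp add: Z_def)
          fix d assume d: "beats d m"
          have "d \<in> U"
          proof (rule ccontr)
            assume "d \<notin> U"
            then have "d \<in> Z" using d m(1) beats_mem[OF d] by (simp add: Z_def)
            then show False using m(2) d beats_asym beats_irrefl by blast
          qed
          moreover have "beats d e"
            using d m(2)[OF \<open>e \<in> Z\<close>] beats_trans by blast
          then have "d \<notin> chosen U" using e by (auto simp: menu_def)
          ultimately show "d \<in> U - chosen U" by simp
        qed
        then show False using m(1) U by (simp add: Z_def)
      qed
    next
      assume "e \<in> U"
      then have "e \<in> \<Phi> U" using U by simp
      then show "e \<in> menu (chosen U)" by (auto simp: \<Phi>_def menu_def)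
    qed
  qed
  then show ?thesis unfolding settled_def by metis
qed

section \<open>Menus are closed under union and intersection\<close>

text \<open>
  By substitutability an edge of \<open>N\<close> that is on the menu of \<open>X\<close> lies in \<open>X\<close>, and likewise for \<open>Y\<close>.
  Hence \<open>N\<close> has at most one edge per agent, and only for agents matched in both \<open>X\<close> and \<open>Y\<close>; but by
  cardinal monotonicity \<open>N\<close> is at least as large as each of \<open>X\<close> and \<open>Y\<close>. So all three match the
  same agents (the rural hospitals theorem), and \<open>N\<close> gives every agent the worse of its two
  edges, which is what the equation for its menu expresses.
\<close>
lemma chosen_from_union_of_menus:
  assumes X: "settled X" and Y: "settled Y"
  defines "N \<equiv> chosen (menu X \<union> menu Y)"
  shows "settled N \<and> menu N = menu X \<union> menu Y \<and> agent ` N = agent ` X \<and> agent ` N = agent ` Y"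
proof -
  have NE: "N \<subseteq> E" unfolding N_def using chosen_subset by blast
  have NX: "e \<in> X" if "e \<in> N" "e \<in> menu X" for e
    using chosen_substitutable[of e "menu X \<union> menu Y" "menu X"] that X
    by (simp add: N_def settled_def)
  have NY: "e \<in> Y" if "e \<in> N" "e \<in> menu Y" for e
    using chosen_substitutable[of e "menu X \<union> menu Y" "menu Y"] that Y
    by (simp add: N_def settled_def)
  have Nm: "e \<in> menu X \<or> e \<in> menu Y" if "e \<in> N" for e
    using that chosen_subset[of "menu X \<union> menu Y"] by (auto simp: N_def)
  have aX: "agent ` N \<subseteq> agent ` X"
  proof
    fix w assume "w \<in> agent ` N"
    then obtain e where e: "e \<in> N" "w = agent e" by blast
    show "w \<in> agent ` X"
    proof (cases "e \<in> menu X")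
      case True
      then show ?thesis using e NX by blast
    next
      case False
      then obtain x where "x \<in> X" "beats x e" using not_menuE e(1) NE by blast
      then show ?thesis using beats_mem e(2) by force
    qed
  qed
  have aY: "agent ` N \<subseteq> agent ` Y"
  proof
    fix w assume "w \<in> agent ` N"
    then obtain e where e: "e \<in> N" "w = agent e" by blast
    show "w \<in> agent ` Y"
    proof (cases "e \<in> menu Y")
      case True
      then show ?thesis using e NY by blast
    next
      case False
      then obtain y where "y \<in> Y" "beats y e" using not_menuE e(1) NE by blast
      then show ?thesis using beats_mem e(2) by force
    qed
  qed
  have "inj_on agent N"
  proof (rule inj_onI, rule ccontr)
    have no: "\<not> beats e e'" if "e \<in> N" "e' \<in> N" for e e'
    proof
      assume b: "beats e e'"
      consider "e' \<in> menu X" | "e' \<in> menu Y" using Nm \<open>e' \<in> N\<close> by blast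
      then show False
      proof cases
        case 1
        then have "e \<in> X" using NX that menu_upward b by blast
        then show False using 1 b by (auto simp: menu_def)
      next
        case 2
        then have "e \<in> Y" using NY that menu_upward b by blast
        then show False using 2 b by (auto simp: menu_def)
      qed
    qed
    fix e e' assume "e \<in> N" "e' \<in> N" "agent e = agent e'" "e \<noteq> e'"
    then show False using no beats_total NE by blast
  qed
  then have cN: "card N = card (agent ` N)" by (simp add: card_image)
  have fin: "finite (agent ` X)" "finite (agent ` Y)"
    using finite_E settled_E[OF X] settled_E[OF Y] finite_subset by blast+
  have "card X \<le> card N" "card Y \<le> card N"
    using card_chosen_mono[of "menu X" "menu X \<union> menu Y"]
      card_chosen_mono[of "menu Y" "menu X \<union> menu Y"] X Y
    by (simp_all add: N_def settled_def)
  then have agX: "agent ` N = agent ` X" and agY: "agent ` N = agent ` Y"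
    by (metis card_seteq[OF fin(1) aX] cN settled_card[OF X],
        metis card_seteq[OF fin(2) aY] cN settled_card[OF Y])
  have "menu N = menu X \<union> menu Y"
  proof (rule Set.set_eqI)
    fix e
    show "e \<in> menu N \<longleftrightarrow> e \<in> menu X \<union> menu Y"
    proof
      assume e: "e \<in> menu N"
      then have eE: "e \<in> E" using menu_E by blast
      show "e \<in> menu X \<union> menu Y"
      proof (rule ccontr)
        assume ne: "e \<notin> menu X \<union> menu Y"
        obtain x where x: "x \<in> X" "beats x e" using ne not_menuE eE by blast
        obtain y where y: "y \<in> Y" "beats y e" using ne not_menuE eE by blast
        have "agent e \<in> agent ` N" using agX x beats_mem by (metis imageI)
        then obtain n where n: "n \<in> N" "agent n = agent e" by force
        from Nm[OF n(1)] have "n = x \<or> n = y"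
          using NX NY n x y beats_mem settled_unique[OF X] settled_unique[OF Y] by metis
        then show False using e n x y by (auto simp: menu_def)
      qed
    next
      assume e: "e \<in> menu X \<union> menu Y"
      have "\<not> beats n e" if "n \<in> N" for n
      proof
        assume b: "beats n e"
        show False
        proof (cases "e \<in> menu X")
          case True
          then have "n \<in> X" using NX that menu_upward b by blast
          then show False using True b by (auto simp: menu_def)
        next
          case False
          then have eY: "e \<in> menu Y" using e by blast
          then have "n \<in> Y" using NY that menu_upward b by blast
          then show False using eY b by (auto simp: menu_def)
        qed
      qed
      then show "e \<in> menu N" using e menu_E by (auto simp: menu_def)
    qed
  qed
  moreover from this have "settled N" unfolding settled_def by (simp add: N_def)
  ultimately show ?thesis using agX agY by blast
qed

lemma settled_join:
  assumes "settled X" "settled Y"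
  obtains N where "settled N" "menu N = menu X \<union> menu Y"
  using that[of "chosen (menu X \<union> menu Y)"] chosen_from_union_of_menus[OF assms] by simp

lemma same_agents: "settled X \<Longrightarrow> settled Y \<Longrightarrow> agent ` X = agent ` Y"
  by (metis chosen_from_union_of_menus)

lemma same_card: "settled X \<Longrightarrow> settled Y \<Longrightarrow> card X = card Y"
  using same_agents[of X Y] settled_card[of X] settled_card[of Y] by simp

lemma partner:
  assumes "settled X" "settled Y" "x \<in> X"
  obtains y where "y \<in> Y" "agent y = agent x"
proof -
  have "agent x \<in> agent ` Y" using same_agents[OF assms(1,2)] assms(3) by blast
  then show thesis using that by force
qed

text \<open>
  Let \<open>K\<close> give every agent the better of its two edges. Substitutability puts all of \<open>K\<close> into the
  choice from the intersection of the menus, and by cardinal monotonicity this choice has at most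
  \<open>card X = card K\<close> elements.
\<close>
lemma settled_meet:
  assumes X: "settled X" and Y: "settled Y"
  obtains K where "settled K" "menu K = menu X \<inter> menu Y"
proof -
  define Z where "Z = menu X \<inter> menu Y"
  define K where "K = (X \<inter> menu Y) \<union> (Y \<inter> menu X)"
  have KZ: "K \<subseteq> Z"
    using settled_menu[OF X] settled_menu[OF Y] by (auto simp: K_def Z_def)
  have "X \<inter> menu Y \<subseteq> chosen Z"
    using chosen_substitutable[of _ "menu X" Z] settled_menu[OF X] settled_chosen_menu[OF X]
    by (auto simp: Z_def)
  moreover have "Y \<inter> menu X \<subseteq> chosen Z"
    using chosen_substitutable[of _ "menu Y" Z] settled_menu[OF Y] settled_chosen_menu[OF Y]
    by (auto simp: Z_def)
  ultimately have KC: "K \<subseteq> chosen Z" by (auto simp: K_def)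
  have better: "\<exists>k\<in>K. agent k = agent x" if x: "x \<in> X" for x
  proof -
    obtain y where y: "y \<in> Y" "agent y = agent x" using partner[OF X Y x] .
    have E: "x \<in> E" "y \<in> E" using settled_E X Y x y by blast+
    show ?thesis
    proof (cases "x \<in> menu Y")
      case True
      then show ?thesis using x by (auto simp: K_def)
    next
      case False
      then have "beats y x"
        using mem_menu_iff[OF Y y(1) E(1)] y(2) beats_total[OF E] by auto
      then have "y \<in> menu X"
        using menu_upward settled_menu[OF X] x by blast
      then show ?thesis using y by (auto simp: K_def)
    qed
  qed
  have finC: "finite (chosen Z)" using chosen_subset finite_E by (meson finite_Int finite_subset)
  have "card (chosen Z) \<le> card X"
    using card_chosen_mono[of Z "menu X"] settled_chosen_menu[OF X] by (simp add: Z_def)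
  also have "\<dots> = card (agent ` X)" using settled_card[OF X] .
  also have "\<dots> \<le> card (agent ` K)"
  proof (rule card_mono)
    show "finite (agent ` K)" using finC KC finite_subset by blast
    show "agent ` X \<subseteq> agent ` K"
    proof
      fix w assume "w \<in> agent ` X"
      then obtain x where "x \<in> X" "w = agent x" by blast
      moreover from this obtain k where "k \<in> K" "agent k = agent x" using better by blast
      ultimately show "w \<in> agent ` K" by (metis imageI)
    qed
  qed
  also have "\<dots> \<le> card K" using finC KC finite_subset card_image_le by blast
  finally have KeqC: "chosen Z = K" using card_seteq[OF finC KC] by simp
  have "menu K = Z"
  proof (rule Set.set_eqI)
    fix e
    show "e \<in> menu K \<longleftrightarrow> e \<in> Z"
    proof
      assume "e \<in> Z"
      then show "e \<in> menu K" by (auto simp: Z_def K_def menu_def)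
    next
      assume e: "e \<in> menu K"
      then have eE: "e \<in> E" using menu_E by blast
      show "e \<in> Z"
      proof (rule ccontr)
        assume "e \<notin> Z"
        then consider "e \<notin> menu X" | "e \<notin> menu Y" by (auto simp: Z_def)
        then obtain x where x: "x \<in> X \<union> Y" "beats x e" using not_menuE[OF eE] by (metis UnI1 UnI2)
        obtain k where k: "k \<in> K" "agent k = agent x"
        proof (cases "x \<in> X")
          case True
          then show ?thesis using better that by blast
        next
          case False
          then obtain x' where "x' \<in> X" "agent x' = agent x" using partner[OF Y X] x by blast
          then show ?thesis using better that by metis
        qed
        have "x \<in> E" "k \<in> E" using x k settled_E X Y KZ menu_E by (auto simp: Z_def)
        moreover have "\<not> beats x k" using k x KZ by (auto simp: Z_def menu_def)
        ultimately have "k = x \<or> beats k x" using beats_total k by blast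
        then have "beats k e" using x beats_trans by blast
        then show False using e k by (auto simp: menu_def)
      qed
    qed
  qed
  then show thesis using that[of K] KeqC by (simp add: settled_def Z_def)
qed

section \<open>Tandem cycles are the covering steps\<close>

definition candidates :: "'e set \<Rightarrow> 'w \<Rightarrow> 'e set" where
  "candidates X w = {e \<in> E. agent e = w \<and> (\<exists>x\<in>X. beats x e) \<and> e \<in> chosen (insert e X)}"

definition admissible :: "'e set \<Rightarrow> 'e \<Rightarrow> bool" where
  "admissible X a \<longleftrightarrow> a \<in> candidates X (agent a)
     \<and> (\<forall>e \<in> candidates X (agent a). e \<noteq> a \<longrightarrow> beats a e)"

definition tandem :: "'e set \<Rightarrow> 'e \<Rightarrow> 'e \<Rightarrow> bool" where
  "tandem X a b \<longleftrightarrow> admissible X a \<and> b \<in> X \<and> chosen (insert a X) = insert a (X - {b})"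

definition tandem_cycle :: "'e set \<Rightarrow> ('e \<times> 'e) list \<Rightarrow> bool" where
  "tandem_cycle X ts \<longleftrightarrow> ts \<noteq> [] \<and> (\<forall>(a, b) \<in> set ts. tandem X a b)
     \<and> distinct (map fst ts) \<and> distinct (map snd ts)
     \<and> (\<forall>i < length ts. agent (snd (ts ! i)) = agent (fst (ts ! (Suc i mod length ts))))"

text \<open>
  Since \<open>menu\<close> is injective on settled sets and \<open>\<prec>\<^sub>F\<close> corresponds to inclusion of menus, this is the
  covering relation of the lattice.
\<close>
definition covers :: "'e set \<Rightarrow> 'e set \<Rightarrow> bool" where
  "covers X Y \<longleftrightarrow> settled X \<and> settled Y \<and> menu X \<subset> menu Y
     \<and> \<not> (\<exists>Z. settled Z \<and> menu X \<subset> menu Z \<and> menu Z \<subset> menu Y)"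

lemma admissible_unique: "admissible X a \<Longrightarrow> admissible X a' \<Longrightarrow> agent a = agent a' \<Longrightarrow> a = a'"
  unfolding admissible_def using beats_asym by metis

lemma admissibleD:
  assumes "admissible X a"
  obtains x where "x \<in> X" "beats x a" "a \<in> E" "a \<in> chosen (insert a X)"
  using assms that by (auto simp: admissible_def candidates_def)

lemma admissible_notin_menu: "admissible X a \<Longrightarrow> a \<notin> menu X"
  by (elim admissibleD) (auto simp: menu_def)

lemma admissible_notin: "settled X \<Longrightarrow> admissible X a \<Longrightarrow> a \<notin> X"
  using admissible_notin_menu settled_menu by blast

lemma tandem_unique:
  assumes "settled X" "tandem X a b" "tandem X a b'"
  shows "b = b'"
proof -
  have "insert a (X - {b}) = insert a (X - {b'})" "a \<notin> X" "b \<in> X" "b' \<in> X"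
    using assms admissible_notin unfolding tandem_def by auto
  then show ?thesis by (metis Diff_iff insertCI insertE singletonD singletonI)
qed

text \<open>
  Here \<open>A\<close> and \<open>B\<close> are the sets \<open>L\<^sup>+\<close> and \<open>L\<^sup>-\<close> of the rotation \<open>L\<close> that traverses \<open>ts\<close>.
\<close>

context
  fixes X ts A B
  assumes X: "settled X" and ts: "tandem_cycle X ts"
  defines "A \<equiv> fst ` set ts" and "B \<equiv> snd ` set ts"
begin

lemma cycle_tandem:
  assumes "p \<in> set ts"
  shows "tandem X (fst p) (snd p)"
  using ts assms by (auto simp: tandem_cycle_def)

lemma cycle_A: "a \<in> A \<Longrightarrow> admissible X a"
  using cycle_tandem by (auto simp: A_def tandem_def)

lemma cycle_B: "B \<subseteq> X"
  using cycle_tandem by (auto simp: B_def tandem_def)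

lemma cycle_A_notin: "A \<inter> X = {}"
  using cycle_A admissible_notin[OF X] by blast

lemma cycle_A_E: "A \<subseteq> E"
  using cycle_A by (auto elim: admissibleD)

text \<open>
  The cycle enters the agent of \<open>a\<close> through an edge of \<open>X\<close>, and that agent has only one.
\<close>
lemma cycle_replaced:
  assumes a: "a \<in> A" and x: "x \<in> X" "agent x = agent a"
  shows "x \<in> B"
proof -
  let ?n = "length ts"
  obtain j where j: "j < ?n" "fst (ts ! j) = a"
    using a by (auto simp: A_def in_set_conv_nth)
  define i where "i = (if j = 0 then ?n - 1 else j - 1)"
  have i: "i < ?n" "Suc i mod ?n = j"
    using j(1) by (auto simp: i_def)
  have "agent (snd (ts ! i)) = agent a"
    using ts i j(2) by (auto simp: tandem_cycle_def)
  moreover have "snd (ts ! i) \<in> B" using i(1) by (auto simp: B_def)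
  ultimately show ?thesis
    using settled_unique[OF X _ x(1)] x(2) cycle_B by auto
qed

lemma cycle_card: "card ((X - B) \<union> A) = card X"
proof -
  have fX: "finite X" using settled_E[OF X] finite_E finite_subset by blast
  have "card A = length ts" "card B = length ts"
    using ts distinct_card[of "map fst ts"] distinct_card[of "map snd ts"]
    by (auto simp: tandem_cycle_def A_def B_def)
  moreover have "card ((X - B) \<union> A) = card (X - B) + card A"
    by (rule card_Un_disjoint) (use fX cycle_A_notin in \<open>auto simp: A_def\<close>)
  moreover have "card (X - B) = card X - card B"
    by (rule card_Diff_subset[OF finite_subset[OF cycle_B fX] cycle_B])
  moreover have "card B \<le> card X" by (rule card_mono[OF fX cycle_B])
  ultimately show ?thesis by simp
qed

text \<open>
  Each \<open>b \<in> B\<close> is rejected already when its own \<open>a\<close> is added to \<open>X\<close>, hence also when all of \<open>A\<close> is.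
  Nothing else is rejected, because the choice must not become smaller and \<open>card A = card B\<close>.
\<close>
lemma cycle_chosen: "chosen (X \<union> A) = (X - B) \<union> A"
proof -
  have fin: "finite ((X - B) \<union> A)"
    using settled_E[OF X] cycle_A_E finite_E by (meson Un_least finite_Diff finite_UnI finite_subset)
  have sub: "chosen (X \<union> A) \<subseteq> (X - B) \<union> A"
  proof
    fix e assume e: "e \<in> chosen (X \<union> A)"
    have "e \<notin> B"
    proof
      assume "e \<in> B"
      then obtain a where a: "(a, e) \<in> set ts" by (auto simp: B_def)
      have t: "tandem X a e" using cycle_tandem[OF a] by simp
      have "a \<in> A" using a by (force simp: A_def)
      then have "e \<in> chosen (insert a X)"
        using chosen_substitutable[OF e, of "insert a X"] t by (auto simp: tandem_def)
      then show False
        using t admissible_notin[OF X] by (auto simp: tandem_def)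
    qed
    then show "e \<in> (X - B) \<union> A" using e chosen_subset by blast
  qed
  have "card ((X - B) \<union> A) \<le> card (chosen (X \<union> A))"
    using card_chosen_mono[of X "X \<union> A"] settled_fixed[OF X] cycle_card by simp
  then show ?thesis using card_seteq[OF fin sub] by simp
qed

lemma menu_before_cycle: "menu X \<subseteq> menu ((X - B) \<union> A)"
proof
  fix e assume e: "e \<in> menu X"
  have "\<not> beats a e" if a: "a \<in> A" for a
  proof
    assume "beats a e"
    obtain x where "x \<in> X" "beats x a" using admissibleD[OF cycle_A[OF a]] .
    then show False using \<open>beats a e\<close> e beats_trans by (auto simp: menu_def)
  qed
  then show "e \<in> menu ((X - B) \<union> A)" using e by (auto simp: menu_def)
qed

lemma cycle_A_menu: "A \<subseteq> menu ((X - B) \<union> A)"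
proof
  fix a assume a: "a \<in> A"
  have "\<not> beats x a" if x: "x \<in> (X - B) \<union> A" for x
  proof
    assume b: "beats x a"
    have ag: "agent x = agent a" using beats_mem[OF b] by simp
    show False
    proof (cases "x \<in> A")
      case True
      then have "x = a" using admissible_unique cycle_A a ag by blast
      then show False using b beats_irrefl by blast
    next
      case False
      then show False using x cycle_replaced[OF a _ ag] by blast
    qed
  qed
  then show "a \<in> menu ((X - B) \<union> A)" using a cycle_A_E by (auto simp: menu_def)
qed

lemma menu_after_cycle:
  assumes "e \<in> menu ((X - B) \<union> A)" "e \<notin> menu X"
  obtains a where "a \<in> A" "agent a = agent e" "e = a \<or> beats e a"
proof -
  have eE: "e \<in> E" using assms(1) menu_E by blast
  obtain x where x: "x \<in> X" "beats x e" using not_menuE[OF eE assms(2)] .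
  then have "x \<in> B" using assms(1) by (auto simp: menu_def)
  then obtain i where i: "i < length ts" "x = snd (ts ! i)"
    by (auto simp: B_def in_set_conv_nth)
  define a where "a = fst (ts ! (Suc i mod length ts))"
  have "Suc i mod length ts < length ts" using i(1) by (intro mod_less_divisor) auto
  then have a: "a \<in> A" by (auto simp: a_def A_def)
  have ag: "agent a = agent e"
    using ts i beats_mem[OF x(2)] by (auto simp: tandem_cycle_def a_def)
  have "\<not> beats a e" using assms(1) a by (auto simp: menu_def)
  then have "e = a \<or> beats e a" using beats_total[OF eE, of a] a ag cycle_A_E by auto
  then show thesis using that a ag by blast
qed

text \<open>
  The menu of the new matching may exceed \<open>X \<union> A\<close>, but nothing outside \<open>X \<union> A\<close> is chosen from it:
  on the old menu only \<open>X\<close> is chosen, and an edge that came newly into play and is chosen would be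
  a candidate at its agent, so it cannot be above the admissible edge there.
\<close>
lemma settled_after_cycle: "settled ((X - B) \<union> A)"
proof -
  let ?X' = "(X - B) \<union> A"
  have Xm: "X \<subseteq> menu ?X'" using settled_menu[OF X] menu_before_cycle by blast
  have "chosen (menu ?X') \<subseteq> X \<union> A"
  proof
    fix e assume e: "e \<in> chosen (menu ?X')"
    then have em: "e \<in> menu ?X'" using chosen_subset by blast
    show "e \<in> X \<union> A"
    proof (cases "e \<in> menu X")
      case True
      then show ?thesis
        using chosen_substitutable[OF e menu_before_cycle True] settled_chosen_menu[OF X] by simp
    next
      case False
      obtain a where a: "a \<in> A" "agent a = agent e" "e = a \<or> beats e a"
        using menu_after_cycle[OF em False] .
      have "e \<in> chosen (insert e X)"
        using chosen_substitutable[OF e, of "insert e X"] Xm em by simp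
      then have "e \<in> candidates X (agent a)"
        using False em a(2) by (auto simp: candidates_def menu_def)
      then have "e = a \<or> beats a e"
        using cycle_A[OF a(1)] by (auto simp: admissible_def)
      then show ?thesis using a beats_asym by blast
    qed
  qed
  moreover have "X \<union> A \<subseteq> menu ?X'" using Xm cycle_A_menu by simp
  ultimately have "chosen (menu ?X') = chosen (X \<union> A)"
    using chosen_consistent by metis
  then show ?thesis using cycle_chosen by (simp add: settled_def)
qed

lemma cycle_increases: "menu X \<subset> menu ((X - B) \<union> A)"
proof -
  have "fst (hd ts) \<in> A" using ts by (auto simp: tandem_cycle_def A_def)
  then show ?thesis
    using menu_before_cycle cycle_A_menu admissible_notin_menu cycle_A by blast
qed

end

text \<open>
  A tandem determines the next one: its second edge leads to an agent, the agent has at most one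
  admissible edge, and that edge belongs to at most one tandem. So a cycle of tandems is an orbit
  and is determined by any of its elements.
\<close>
lemma tandem_cycle_subset:
  assumes X: "settled X" and ts: "tandem_cycle X ts" and us: "tandem_cycle X us"
    and p: "p \<in> set ts" "p \<in> set us"
  shows "set ts \<subseteq> set us"
proof -
  let ?n = "length ts" and ?m = "length us"
  have step: "ts ! (Suc i mod ?n) \<in> set us" if i: "i < ?n" "ts ! i \<in> set us" for i
  proof -
    obtain j where j: "j < ?m" "us ! j = ts ! i" using i(2) by (auto simp: in_set_conv_nth)
    let ?q = "ts ! (Suc i mod ?n)" and ?r = "us ! (Suc j mod ?m)"
    have "Suc i mod ?n < ?n" using i(1) by (intro mod_less_divisor) auto
    then have q: "?q \<in> set ts" by simp
    have "Suc j mod ?m < ?m" using j(1) by (intro mod_less_divisor) auto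
    then have r: "?r \<in> set us" by simp
    have tq: "tandem X (fst ?q) (snd ?q)" using cycle_tandem[OF X ts q] .
    have tr: "tandem X (fst ?r) (snd ?r)" using cycle_tandem[OF X us r] .
    have "agent (fst ?q) = agent (fst ?r)"
      using ts us i(1) j by (metis tandem_cycle_def)
    then have "fst ?q = fst ?r"
      using admissible_unique tq tr by (auto simp: tandem_def)
    moreover from this have "snd ?q = snd ?r"
      using tandem_unique[OF X] tq tr by metis
    ultimately show ?thesis using r by (metis prod_eq_iff)
  qed
  obtain i where i: "i < ?n" "ts ! i = p" using p(1) by (auto simp: in_set_conv_nth)
  have *: "ts ! ((i + k) mod ?n) \<in> set us" for k
  proof (induction k)
    case 0
    then show ?case using i p by simp
  next
    case (Suc k)
    have "(i + k) mod ?n < ?n" using i(1) by (intro mod_less_divisor) auto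
    then show ?case using step[OF _ Suc] by (simp add: mod_Suc_eq)
  qed
  show ?thesis
  proof
    fix q assume "q \<in> set ts"
    then obtain j where j: "j < ?n" "ts ! j = q" by (auto simp: in_set_conv_nth)
    have "(i + (?n - i + j)) mod ?n = j" using i(1) j(1) by simp
    then show "q \<in> set us" using *[of "?n - i + j"] j by simp
  qed
qed

lemma finite_map_has_cycle:
  assumes "finite S" "S \<noteq> {}" "\<And>x. x \<in> S \<Longrightarrow> g x \<in> S"
  obtains x n where "x \<in> S" "0 < n" "(g ^^ n) x = x" "inj_on (\<lambda>k. (g ^^ k) x) {0..<n}"
proof -
  obtain x0 where "x0 \<in> S" using assms(2) by blast
  have inS: "(g ^^ k) x0 \<in> S" for k
    by (induction k) (auto simp: \<open>x0 \<in> S\<close> assms(3))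
  have "\<not> inj (\<lambda>k. (g ^^ k) x0)"
  proof
    assume "inj (\<lambda>k. (g ^^ k) x0)"
    moreover have "finite (range (\<lambda>k. (g ^^ k) x0))"
      by (rule finite_subset[OF _ assms(1)]) (use inS in auto)
    ultimately show False using finite_imageD infinite_UNIV_nat by blast
  qed
  then obtain i j where ij: "i < j" "(g ^^ i) x0 = (g ^^ j) x0"
    unfolding inj_def by (metis nat_neq_iff)
  define x where "x = (g ^^ i) x0"
  have "(g ^^ (j - i)) x = (g ^^ (j - i + i)) x0"
    unfolding x_def funpow_add by simp
  then have ex: "0 < j - i \<and> (g ^^ (j - i)) x = x"
    using ij by (simp add: x_def)
  define n where "n = (LEAST n. 0 < n \<and> (g ^^ n) x = x)"
  have n: "0 < n \<and> (g ^^ n) x = x" unfolding n_def by (rule LeastI[of "\<lambda>n. 0 < n \<and> (g ^^ n) x = x", OF ex])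
  have "inj_on (\<lambda>k. (g ^^ k) x) {0..<n}"
  proof (rule inj_on_funpow_least)
    fix m assume "0 < m" "m < n"
    then show "(g ^^ m) x \<noteq> x" using not_less_Least[of m] unfolding n_def by blast
  qed (use n in simp)
  then show thesis using that[of x n] n inS[of i] by (simp add: x_def)
qed

text \<open>
  An agent that does strictly worse in \<open>Y\<close> than in \<open>X\<close> has a candidate, namely its edge in \<open>Y\<close>, so
  its admissible edge \<open>a\<close> exists and lies on the menu of \<open>Y\<close>. Adding all of \<open>Y\<close> to \<open>X \<union> {a}\<close>
  would lead to the choice \<open>Y\<close>, which has the size of \<open>X\<close>; hence the choice from \<open>X \<union> {a}\<close> cannot be
  larger than \<open>X\<close>, so some \<open>b\<close> is rejected, and what is rejected there is not in \<open>Y\<close> either.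
\<close>
lemma tandem_below:
  assumes X: "settled X" and Y: "settled Y" and le: "menu X \<subseteq> menu Y" and x: "x \<in> X - Y"
  shows "\<exists>a b. agent a = agent x \<and> a \<in> menu Y \<and> tandem X a b \<and> b \<in> X - Y"
proof -
  have xX: "x \<in> X" using x by simp
  obtain y where y: "y \<in> Y" "agent y = agent x" using partner[OF X Y xX] .
  have E: "x \<in> E" "y \<in> E" using settled_E X Y xX y by blast+
  have "x \<in> menu Y" using le settled_menu[OF X] xX by blast
  then have xy: "beats x y"
    using mem_menu_iff[OF Y y(1) E(1)] x y by auto
  have Xm: "X \<subseteq> menu Y" using le settled_menu[OF X] by blast
  have "y \<in> chosen (insert y X)"
    using chosen_substitutable[of y "menu Y" "insert y X"] settled_chosen_menu[OF Y]
      settled_menu[OF Y] y Xm by auto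
  then have yc: "y \<in> candidates X (agent x)"
    using xX xy y E by (auto simp: candidates_def)
  have "candidates X (agent x) \<subseteq> E" "candidates X (agent x) \<noteq> {}"
    "\<And>e. e \<in> candidates X (agent x) \<Longrightarrow> agent e = agent x"
    using yc by (auto simp: candidates_def)
  from best_exists[OF this] obtain a where a: "a \<in> candidates X (agent x)"
    "\<And>e. e \<in> candidates X (agent x) \<Longrightarrow> e \<noteq> a \<Longrightarrow> beats a e" by metis
  have ag: "agent a = agent x" and aE: "a \<in> E" and ac: "a \<in> chosen (insert a X)"
    using a(1) by (auto simp: candidates_def)
  have adm: "admissible X a" using a ag by (simp add: admissible_def)
  have "y = a \<or> beats a y" using a(2) yc by blast
  then have am: "a \<in> menu Y" using mem_menu_iff[OF Y y(1) aE] ag y(2) by auto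
  have aX: "a \<notin> X" using admissible_notin[OF X adm] .
  have fX: "finite X" using settled_E[OF X] finite_E finite_subset by blast
  have all: "chosen (insert a (X \<union> Y)) = Y"
    by (rule settled_between[OF Y]) (use am Xm settled_menu[OF Y] in auto)
  have sub: "chosen (insert a X) \<subseteq> insert a X" using chosen_subset by blast
  have "card (chosen (insert a X)) \<le> card X"
    using card_chosen_mono[of "insert a X" "insert a (X \<union> Y)"] all same_card[OF X Y] by auto
  moreover have "card X \<le> card (chosen (insert a X))"
    using card_chosen_mono[of X "insert a X"] settled_fixed[OF X] by auto
  ultimately have "card (insert a X - chosen (insert a X)) = 1"
    using card_Diff_subset[OF finite_subset[OF sub] sub] fX aX by simp
  then obtain b where b: "insert a X - chosen (insert a X) = {b}" by (auto simp: card_1_singleton_iff)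
  then have bX: "b \<in> X" using ac by auto
  have "chosen (insert a X) = insert a (X - {b})" using b sub ac by auto
  then have "tandem X a b" using adm bX by (simp add: tandem_def)
  moreover have "b \<notin> Y"
  proof
    assume "b \<in> Y"
    then have "b \<in> chosen (insert a X)"
      using chosen_substitutable[of b "insert a (X \<union> Y)" "insert a X"] all bX by auto
    then show False using b by auto
  qed
  ultimately show ?thesis using ag am bX by blast
qed

text \<open>
  By the preceding lemma the tandems define a map of the finite set \<open>X - Y\<close> into itself, and a
  periodic orbit of this map is a cycle. Its admissible edges are on the menu of \<open>Y\<close>, so the
  matching obtained is still below \<open>Y\<close>.
\<close>
lemma tandem_cycle_below:
  assumes X: "settled X" and Y: "settled Y" and lt: "menu X \<subset> menu Y"
  obtains ts where "tandem_cycle X ts" "menu ((X - snd ` set ts) \<union> fst ` set ts) \<subseteq> menu Y"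
proof -
  obtain \<alpha> g where ag: "\<And>x. x \<in> X - Y \<Longrightarrow> agent (\<alpha> x) = agent x"
    and am: "\<And>x. x \<in> X - Y \<Longrightarrow> \<alpha> x \<in> menu Y"
    and tan: "\<And>x. x \<in> X - Y \<Longrightarrow> tandem X (\<alpha> x) (g x)"
    and gS: "\<And>x. x \<in> X - Y \<Longrightarrow> g x \<in> X - Y"
    using tandem_below[OF X Y] lt by (metis psubset_imp_subset)
  have fX: "finite X" using settled_E[OF X] finite_E finite_subset by blast
  have fY: "finite Y" using settled_E[OF Y] finite_E finite_subset by blast
  have "X - Y \<noteq> {}"
    using card_seteq[OF fY, of X] same_card[OF X Y] lt by auto
  then obtain x n where x: "x \<in> X - Y" and n: "0 < n" and cyc: "(g ^^ n) x = x"
    and inj: "inj_on (\<lambda>k. (g ^^ k) x) {0..<n}"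
    using finite_map_has_cycle[of "X - Y" g] fX gS by (metis finite_Diff)
  have inS: "(g ^^ k) x \<in> X - Y" for k
    by (induction k) (auto simp del: Diff_iff simp: x gS)
  define ts where "ts = map (\<lambda>k. (\<alpha> ((g ^^ k) x), (g ^^ Suc k) x)) [0..<n]"
  have len: "length ts = n" by (simp add: ts_def)
  have nth: "ts ! k = (\<alpha> ((g ^^ k) x), (g ^^ Suc k) x)" if "k < n" for k
    using that by (simp add: ts_def)
  \<comment> \<open>The orbit closes after \<open>n\<close> steps, which turns the successor modulo \<open>n\<close> into one application of \<open>g\<close>.\<close>
  have wrap: "(g ^^ (Suc k mod n)) x = (g ^^ Suc k) x" if "k < n" for k
    using that cyc by (cases "Suc k = n") auto
  have "tandem_cycle X ts"
    unfolding tandem_cycle_def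
  proof (intro conjI allI impI ballI)
    show "ts \<noteq> []" using n len by auto
    show "case p of (a, b) \<Rightarrow> tandem X a b" if "p \<in> set ts" for p
      using that tan[OF inS] by (auto simp: ts_def)
    have ag_inj: "k = l" if "k < n" "l < n" "agent ((g ^^ k) x) = agent ((g ^^ l) x)" for k l
    proof -
      have "(g ^^ k) x = (g ^^ l) x" using settled_unique[OF X] inS that(3) by blast
      then show ?thesis using inj that(1,2) by (auto dest: inj_onD)
    qed
    show "distinct (map fst ts)"
      unfolding distinct_conv_nth
    proof (intro allI impI)
      fix k l assume "k < length (map fst ts)" "l < length (map fst ts)" "k \<noteq> l"
      then have "k < n" "l < n" "k \<noteq> l" by (simp_all add: len)
      then have "agent (\<alpha> ((g ^^ k) x)) \<noteq> agent (\<alpha> ((g ^^ l) x))"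
        using ag_inj ag[OF inS] by auto
      then show "map fst ts ! k \<noteq> map fst ts ! l"
        using \<open>k < n\<close> \<open>l < n\<close> by (auto simp: len nth)
    qed
    show "distinct (map snd ts)"
      unfolding distinct_conv_nth
    proof (intro allI impI notI)
      fix k l assume kl: "k < length (map snd ts)" "l < length (map snd ts)" "k \<noteq> l"
        and eq: "map snd ts ! k = map snd ts ! l"
      then have kn: "k < n" "l < n" by (simp_all add: len)
      then have "(g ^^ (Suc k mod n)) x = (g ^^ (Suc l mod n)) x"
        using eq wrap by (simp add: len nth)
      moreover have "Suc k mod n < n" "Suc l mod n < n" using n by simp_all
      ultimately have "Suc k mod n = Suc l mod n" using inj by (auto dest: inj_onD)
      then show False using kn kl(3) by (auto simp: mod_Suc split: if_splits)
    qed
    fix i assume "i < length ts"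
    then have i: "i < n" by (simp add: len)
    have "Suc i mod n < n" using n by simp
    then show "agent (snd (ts ! i)) = agent (fst (ts ! (Suc i mod length ts)))"
      using i wrap ag[OF inS[of "Suc i"]] by (simp add: len nth)
  qed
  moreover have "menu ((X - snd ` set ts) \<union> fst ` set ts) \<subseteq> menu Y"
  proof
    fix e assume e: "e \<in> menu ((X - snd ` set ts) \<union> fst ` set ts)"
    show "e \<in> menu Y"
    proof (cases "e \<in> menu X")
      case True
      then show ?thesis using lt by blast
    next
      case False
      obtain a where a: "a \<in> fst ` set ts" "e = a \<or> beats e a"
        using menu_after_cycle[OF X calculation e False] .
      have "a \<in> menu Y" using a(1) am[OF inS] by (auto simp: ts_def)
      then show ?thesis using a(2) menu_upward by blast
    qed
  qed
  ultimately show thesis using that by blast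
qed

text \<open>
  Anything settled strictly between would, by \<open>tandem_cycle_below\<close>, lie above the result of another
  cycle \<open>us\<close>. An admissible edge of \<open>us\<close> is new on the menu, so its agent is on \<open>ts\<close> as well; hence
  the two cycles share a tandem and coincide.
\<close>
lemma tandem_cycle_covers:
  assumes X: "settled X" and ts: "tandem_cycle X ts"
  shows "covers X ((X - snd ` set ts) \<union> fst ` set ts)" (is "covers X ?X'")
  unfolding covers_def
proof (intro conjI notI)
  show "settled X" "settled ?X'" "menu X \<subset> menu ?X'"
    using X settled_after_cycle[OF X ts] cycle_increases[OF X ts] by auto
  assume "\<exists>Z. settled Z \<and> menu X \<subset> menu Z \<and> menu Z \<subset> menu ?X'"
  then obtain Z where Z: "settled Z" "menu X \<subset> menu Z" "menu Z \<subset> menu ?X'" by blast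
  obtain us where us: "tandem_cycle X us"
    "menu ((X - snd ` set us) \<union> fst ` set us) \<subseteq> menu Z"
    using tandem_cycle_below[OF X Z(1,2)] .
  have "us \<noteq> []" using us(1) by (simp add: tandem_cycle_def)
  then have pu: "hd us \<in> set us" by simp
  let ?a = "fst (hd us)"
  have tu: "tandem X ?a (snd (hd us))" using cycle_tandem[OF X us(1) pu] .
  have "?a \<in> menu ?X'" using cycle_A_menu[OF X us(1)] pu us(2) Z(3) by blast
  moreover have "?a \<notin> menu X" using tu admissible_notin_menu by (auto simp: tandem_def)
  ultimately obtain a where a: "a \<in> fst ` set ts" "agent a = agent ?a"
    by (rule menu_after_cycle[OF X ts])
  then obtain q where q: "q \<in> set ts" "fst q = a" by blast
  have tq: "tandem X (fst q) (snd q)" using cycle_tandem[OF X ts q(1)] .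
  have "fst q = ?a" using tq tu a(2) q(2) admissible_unique by (auto simp: tandem_def)
  moreover from this have "snd q = snd (hd us)" using tandem_unique[OF X] tq tu by metis
  ultimately have "q = hd us" by (metis prod_eq_iff)
  then have "set ts = set us"
    using tandem_cycle_subset[OF X ts us(1) q(1)] tandem_cycle_subset[OF X us(1) ts _ q(1)] q(1) pu
    by auto
  then show False using us(2) Z(3) by auto
qed

lemma covers_iff_tandem_cycle:
  assumes X: "settled X"
  shows "covers X Y \<longleftrightarrow> (\<exists>ts. tandem_cycle X ts \<and> Y = (X - snd ` set ts) \<union> fst ` set ts)"
proof
  assume c: "covers X Y"
  then have Y: "settled Y" "menu X \<subset> menu Y" by (auto simp: covers_def)
  obtain ts where ts: "tandem_cycle X ts" "menu ((X - snd ` set ts) \<union> fst ` set ts) \<subseteq> menu Y"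
    using tandem_cycle_below[OF X Y] .
  have "menu ((X - snd ` set ts) \<union> fst ` set ts) = menu Y"
    using c ts tandem_cycle_covers[OF X ts(1)] by (auto simp: covers_def)
  then have "Y = (X - snd ` set ts) \<union> fst ` set ts"
    using menu_inj Y(1) settled_after_cycle[OF X ts(1)] by metis
  then show "\<exists>ts. tandem_cycle X ts \<and> Y = (X - snd ` set ts) \<union> fst ` set ts"
    using ts(1) by blast
qed (use tandem_cycle_covers[OF X] in blast)

section \<open>Labels of covering steps\<close>

lemma cover_exists:
  assumes "settled X" "settled Y" "menu X \<subset> menu Y"
  obtains Z where "covers X Z" "menu Z \<subseteq> menu Y"
  using tandem_cycle_below[OF assms] tandem_cycle_covers[OF assms(1)] that by metis

lemma coversD:
  assumes "covers X Y"
  shows "settled X" "settled Y" "menu X \<subseteq> menu Y" "menu Y - menu X \<noteq> {}"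
  using assms by (auto simp: covers_def)

definition step_label :: "'e set \<Rightarrow> 'e set \<Rightarrow> 'e set \<times> 'e set" where
  "step_label X Y = (Y - X, X - Y)"

definition labels :: "('e set \<times> 'e set) set" where
  "labels = {step_label X Y | X Y. covers X Y}"

text \<open>
  An agent moved from \<open>b\<close> down to \<open>a\<close> contributes the edges from just below \<open>b\<close> down to \<open>a\<close>.
  The formula refers to the pair only, so that the block of a rotation makes sense without a
  matching to which it is applied.
\<close>
definition block :: "'e set \<times> 'e set \<Rightarrow> 'e set" where
  "block R = {e. \<exists>a \<in> fst R. \<exists>b \<in> snd R. beats b e \<and> (e = a \<or> beats e a)}"

lemma block_step_label:
  assumes X: "settled X" and Y: "settled Y" and le: "menu X \<subseteq> menu Y"
  shows "block (step_label X Y) = menu Y - menu X"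
proof (rule Set.set_eqI)
  fix e
  show "e \<in> block (step_label X Y) \<longleftrightarrow> e \<in> menu Y - menu X"
  proof
    assume "e \<in> block (step_label X Y)"
    then obtain a b where ab: "a \<in> Y" "b \<in> X" "beats b e" "e = a \<or> beats e a"
      by (auto simp: block_def step_label_def)
    have "a \<in> menu Y" using ab(1) settled_menu[OF Y] by blast
    then have "e \<in> menu Y" using ab(4) menu_upward by blast
    then show "e \<in> menu Y - menu X" using ab(2,3) by (auto simp: menu_def)
  next
    assume e: "e \<in> menu Y - menu X"
    then have eE: "e \<in> E" using menu_E by blast
    obtain x where x: "x \<in> X" "beats x e" using not_menuE[OF eE] e by blast
    obtain y where y: "y \<in> Y" "agent y = agent x" using partner[OF X Y x(1)] .
    have "e = y \<or> beats e y"
      using mem_menu_iff[OF Y y(1) eE] e y(2) beats_mem[OF x(2)] by auto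
    moreover have xY: "x \<notin> Y" using e x by (auto simp: menu_def)
    moreover have "y \<notin> X" using settled_unique[OF X _ x(1) y(2)] y(1) xY by auto
    ultimately show "e \<in> block (step_label X Y)"
      using x y by (auto simp: block_def step_label_def)
  qed
qed

text \<open>
  The next two lemmas recover the label from the block alone. At each agent that is moved the
  block is an interval: its lowest element is the new edge, and the edge immediately above it is
  the old one.
\<close>
lemma mem_new_iff:
  assumes X: "settled X" and Y: "settled Y" and le: "menu X \<subseteq> menu Y"
  shows "e \<in> Y - X \<longleftrightarrow> e \<in> menu Y - menu X \<and> (\<forall>d \<in> menu Y - menu X. \<not> beats e d)"
proof
  assume e: "e \<in> Y - X"
  then have eY: "e \<in> Y" by simp
  obtain x where x: "x \<in> X" "agent x = agent e" using partner[OF Y X eY] .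
  have eE: "e \<in> E" using settled_E[OF Y] eY by blast
  have "e \<notin> menu X"
  proof
    assume "e \<in> menu X"
    then have "beats e x" using mem_menu_iff[OF X x(1) eE] x e by auto
    moreover have "x \<in> menu Y" using settled_menu[OF X] le x by blast
    ultimately show False using eY by (auto simp: menu_def)
  qed
  then show "e \<in> menu Y - menu X \<and> (\<forall>d \<in> menu Y - menu X. \<not> beats e d)"
    using eY settled_menu[OF Y] by (auto simp: menu_def)
next
  assume e: "e \<in> menu Y - menu X \<and> (\<forall>d \<in> menu Y - menu X. \<not> beats e d)"
  then have eE: "e \<in> E" using menu_E by blast
  obtain x where x: "x \<in> X" "beats x e" using not_menuE[OF eE] e by blast
  obtain y where y: "y \<in> Y" "agent y = agent x" using partner[OF X Y x(1)] .
  have ey: "e = y \<or> beats e y"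
    using mem_menu_iff[OF Y y(1) eE] e y(2) beats_mem[OF x(2)] by auto
  have "e = y"
  proof (rule ccontr)
    assume "e \<noteq> y"
    then have b: "beats e y" using ey by blast
    then have "beats x y" using x beats_trans by blast
    then have "y \<in> menu Y - menu X" using x y settled_menu[OF Y] by (auto simp: menu_def)
    then show False using e b by blast
  qed
  then show "e \<in> Y - X" using y e settled_menu[OF X] by blast
qed

lemma mem_old_iff:
  assumes X: "settled X" and Y: "settled Y" and le: "menu X \<subseteq> menu Y"
  shows "e \<in> X - Y \<longleftrightarrow> e \<notin> menu Y - menu X \<and>
    (\<exists>d \<in> menu Y - menu X. beats e d \<and>
       (\<forall>e'. beats e e' \<longrightarrow> beats e' d \<longrightarrow> e' \<in> menu Y - menu X))"
proof
  assume e: "e \<in> X - Y"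
  then have eX: "e \<in> X" by simp
  obtain y where y: "y \<in> Y" "agent y = agent e" using partner[OF X Y eX] .
  have eE: "e \<in> E" using settled_E[OF X] eX by blast
  have "e \<in> menu Y" using settled_menu[OF X] le eX by blast
  then have ey: "beats e y" using mem_menu_iff[OF Y y(1) eE] y e by auto
  have "y \<in> menu Y - menu X" using ey eX y settled_menu[OF Y] by (auto simp: menu_def)
  moreover have "e' \<in> menu Y - menu X" if "beats e e'" "beats e' y" for e'
  proof -
    have "e' \<in> menu Y" using that(2) y(1) settled_menu[OF Y] menu_upward by blast
    then show ?thesis using that(1) eX by (auto simp: menu_def)
  qed
  ultimately show "e \<notin> menu Y - menu X \<and>
    (\<exists>d \<in> menu Y - menu X. beats e d \<and>
       (\<forall>e'. beats e e' \<longrightarrow> beats e' d \<longrightarrow> e' \<in> menu Y - menu X))"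
    using ey settled_menu[OF X] eX by blast
next
  assume e: "e \<notin> menu Y - menu X \<and>
    (\<exists>d \<in> menu Y - menu X. beats e d \<and>
       (\<forall>e'. beats e e' \<longrightarrow> beats e' d \<longrightarrow> e' \<in> menu Y - menu X))"
  then obtain d where d: "d \<in> menu Y" "d \<notin> menu X" "beats e d"
    and between: "\<And>e'. beats e e' \<Longrightarrow> beats e' d \<Longrightarrow> e' \<in> menu Y - menu X" by blast
  have dE: "d \<in> E" using d menu_E by blast
  obtain x where x: "x \<in> X" "beats x d" using not_menuE[OF dE d(2)] .
  have "e \<in> E" "x \<in> E" "agent e = agent x" using beats_mem[OF d(3)] beats_mem[OF x(2)] by auto
  then have "e = x \<or> beats e x \<or> beats x e" using beats_total by blast
  moreover have "\<not> beats e x" using between[of x] x settled_menu[OF X] by blast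
  moreover have "\<not> beats x e"
  proof
    assume "beats x e"
    then have "e \<notin> menu X" using x by (auto simp: menu_def)
    then show False using e d menu_upward by blast
  qed
  ultimately have "e = x" by blast
  then show "e \<in> X - Y" using x d by (auto simp: menu_def)
qed

lemma step_label_determined:
  assumes "settled X" "settled Y" "menu X \<subseteq> menu Y"
    and "settled X'" "settled Y'" "menu X' \<subseteq> menu Y'"
    and "menu Y - menu X = menu Y' - menu X'"
  shows "step_label X Y = step_label X' Y'"
proof -
  have "Y - X = Y' - X'"
    using mem_new_iff[OF assms(1-3)] mem_new_iff[OF assms(4-6)] assms(7)
    by (intro Set.set_eqI) simp
  moreover have "X - Y = X' - Y'"
    using mem_old_iff[OF assms(1-3)] mem_old_iff[OF assms(4-6)] assms(7)
    by (intro Set.set_eqI) simp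
  ultimately show ?thesis by (simp add: step_label_def)
qed

text \<open>
  The settled set \<open>N\<close> with menu \<open>menu X \<union> (menu Y \<inter> menu Z)\<close> lies between \<open>X\<close> and \<open>Y\<close>, so it is one of
  them.
\<close>
lemma cover_block_dichotomy:
  assumes c: "covers X Y" and Z: "settled Z"
  shows "menu Y - menu X \<subseteq> menu Z \<or> (menu Y - menu X) \<inter> menu Z = {}"
proof -
  note X = coversD(1)[OF c] and Y = coversD(2)[OF c] and le = coversD(3)[OF c]
  obtain K where K: "settled K" "menu K = menu Y \<inter> menu Z" using settled_meet[OF Y Z] .
  obtain N where N: "settled N" "menu N = menu X \<union> menu K" using settled_join[OF X K(1)] .
  have "menu X \<subseteq> menu N" "menu N \<subseteq> menu Y" using N K le by auto
  then have "menu N = menu X \<or> menu N = menu Y"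
    using c N(1) by (auto simp: covers_def)
  then show ?thesis using N(2) K(2) by blast
qed

lemma labelE:
  assumes "L \<in> labels"
  obtains X Y where "covers X Y" "L = step_label X Y" "block L = menu Y - menu X"
  using assms block_step_label coversD unfolding labels_def by blast

lemma block_nonempty: "L \<in> labels \<Longrightarrow> block L \<noteq> {}"
  by (metis labelE coversD(4))

lemma block_dichotomy:
  "L \<in> labels \<Longrightarrow> settled Z \<Longrightarrow> block L \<subseteq> menu Z \<or> block L \<inter> menu Z = {}"
  by (elim labelE) (simp add: cover_block_dichotomy)

text \<open>
  A common element forces, by the dichotomy, each block to be contained in the other; equal
  blocks have equal labels.
\<close>
lemma blocks_disjoint:
  assumes L: "L \<in> labels" "L' \<in> labels" and p: "p \<in> block L" "p \<in> block L'"
  shows "L = L'"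
proof -
  obtain X Y where XY: "covers X Y" "L = step_label X Y" "block L = menu Y - menu X"
    using labelE[OF L(1)] .
  obtain X' Y' where XY': "covers X' Y'" "L' = step_label X' Y'" "block L' = menu Y' - menu X'"
    using labelE[OF L(2)] .
  have "block L \<subseteq> menu Y'" "block L \<inter> menu X' = {}"
    using block_dichotomy[OF L(1) coversD(2)[OF XY'(1)]]
      block_dichotomy[OF L(1) coversD(1)[OF XY'(1)]] p XY'(3) by auto
  moreover have "block L' \<subseteq> menu Y" "block L' \<inter> menu X = {}"
    using block_dichotomy[OF L(2) coversD(2)[OF XY(1)]]
      block_dichotomy[OF L(2) coversD(1)[OF XY(1)]] p XY(3) by auto
  ultimately have "menu Y - menu X = menu Y' - menu X'" using XY(3) XY'(3) by auto
  then show ?thesis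
    using step_label_determined[OF coversD(1-3)[OF XY(1)] coversD(1-3)[OF XY'(1)]] XY(2) XY'(2)
    by simp
qed

section \<open>The labels passed by a settled set\<close>

text \<open>
  This is the value of \<open>\<omega>\<close>, described without reference to routes.
\<close>
definition passed :: "'e set \<Rightarrow> ('e set \<times> 'e set) set" where
  "passed X = {L \<in> labels. block L \<subseteq> menu X}"

lemma passed_mono: "menu X \<subseteq> menu Y \<Longrightarrow> passed X \<subseteq> passed Y"
  by (auto simp: passed_def)

lemma passed_join:
  assumes "settled X" "settled Y" "menu N = menu X \<union> menu Y"
  shows "passed N = passed X \<union> passed Y"
proof (rule Set.set_eqI)
  fix L
  show "L \<in> passed N \<longleftrightarrow> L \<in> passed X \<union> passed Y"
    using block_dichotomy[OF _ assms(1), of L] assms(3) by (auto simp: passed_def)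
qed

lemma passed_meet: "menu K = menu X \<inter> menu Y \<Longrightarrow> passed K = passed X \<inter> passed Y"
  by (auto simp: passed_def)

text \<open>
  If \<open>X\<close> is not below \<open>Y\<close>, then a covering step from the meet of \<open>X\<close> and \<open>Y\<close> towards \<open>X\<close> has a block
  inside the menu of \<open>X\<close> but outside that of \<open>Y\<close>.
\<close>
lemma passed_subset_iff:
  assumes X: "settled X" and Y: "settled Y"
  shows "passed X \<subseteq> passed Y \<longleftrightarrow> menu X \<subseteq> menu Y"
proof
  assume le: "passed X \<subseteq> passed Y"
  obtain K where K: "settled K" "menu K = menu X \<inter> menu Y" using settled_meet[OF X Y] .
  show "menu X \<subseteq> menu Y"
  proof (rule ccontr)
    assume "\<not> menu X \<subseteq> menu Y"
    then have "menu K \<subset> menu X" using K(2) by blast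
    from cover_exists[OF K(1) X this]
    obtain Z where Z: "covers K Z" "menu Z \<subseteq> menu X" .
    have L: "step_label K Z \<in> labels" using Z(1) by (auto simp: labels_def)
    have b: "block (step_label K Z) = menu Z - menu K"
      using block_step_label[OF coversD(1-3)[OF Z(1)]] .
    then have "step_label K Z \<in> passed X" using L Z(2) by (auto simp: passed_def)
    then have "step_label K Z \<in> passed Y" using le by blast
    then have "menu Z - menu K \<subseteq> menu K" using b Z(2) K(2) by (auto simp: passed_def)
    then show False using coversD(4)[OF Z(1)] by blast
  qed
qed (rule passed_mono)

lemma passed_cover:
  assumes c: "covers X Y"
  shows "passed Y = insert (step_label X Y) (passed X)" "step_label X Y \<notin> passed X"
proof -
  have L: "step_label X Y \<in> labels" using c by (auto simp: labels_def)
  have b: "block (step_label X Y) = menu Y - menu X"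
    using block_step_label[OF coversD(1-3)[OF c]] .
  show "step_label X Y \<notin> passed X" using b coversD(4)[OF c] by (auto simp: passed_def)
  show "passed Y = insert (step_label X Y) (passed X)"
  proof
    show "insert (step_label X Y) (passed X) \<subseteq> passed Y"
      using passed_mono[OF coversD(3)[OF c]] L b by (auto simp: passed_def)
    show "passed Y \<subseteq> insert (step_label X Y) (passed X)"
    proof
      fix L' assume L': "L' \<in> passed Y"
      then have lab: "L' \<in> labels" and sub: "block L' \<subseteq> menu Y" by (auto simp: passed_def)
      consider "block L' \<subseteq> menu X" | "block L' \<inter> menu X = {}"
        using block_dichotomy[OF lab coversD(1)[OF c]] by blast
      then show "L' \<in> insert (step_label X Y) (passed X)"
      proof cases
        case 1
        then show ?thesis using lab by (auto simp: passed_def)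
      next
        case 2
        obtain p where "p \<in> block L'" using block_nonempty[OF lab] by blast
        moreover from this have "p \<in> block (step_label X Y)" using 2 sub b by blast
        ultimately show ?thesis using blocks_disjoint[OF lab L] by blast
      qed
    qed
  qed
qed

lemma finite_menu: "finite (menu X)"
  by (rule finite_subset[OF menu_E finite_E])

lemma least_settled:
  assumes ex: "settled X" "P (menu X)"
    and meet: "\<And>U V. P U \<Longrightarrow> P V \<Longrightarrow> P (U \<inter> V)"
  obtains M where "settled M" "P (menu M)" "\<And>Z. settled Z \<Longrightarrow> P (menu Z) \<Longrightarrow> menu M \<subseteq> menu Z"
proof -
  obtain M where M: "settled M \<and> P (menu M)"
    and min: "\<And>Z. settled Z \<and> P (menu Z) \<Longrightarrow> card (menu M) \<le> card (menu Z)"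
    using ex_has_least_nat[of "\<lambda>Z. settled Z \<and> P (menu Z)" X "\<lambda>Z. card (menu Z)"] ex by blast
  have "menu M \<subseteq> menu Z" if Z: "settled Z" "P (menu Z)" for Z
  proof -
    obtain K where K: "settled K" "menu K = menu M \<inter> menu Z" using settled_meet M Z(1) by blast
    then have "card (menu M) \<le> card (menu K)" using min M Z meet by metis
    then show ?thesis using card_seteq[OF finite_menu, of "menu K" M] K(2) by blast
  qed
  then show thesis using that M by blast
qed

lemma greatest_settled:
  assumes ex: "settled X" "P X"
  obtains M where "settled M" "P M" "\<And>Z. settled Z \<Longrightarrow> P Z \<Longrightarrow> menu M \<subseteq> menu Z \<Longrightarrow> menu Z = menu M"
proof -
  have "\<forall>Z. settled Z \<and> P Z \<longrightarrow> card (menu Z) \<le> card E"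
    by (simp add: card_mono[OF finite_E menu_E])
  then obtain M where M: "settled M \<and> P M"
    and max: "\<And>Z. settled Z \<and> P Z \<Longrightarrow> card (menu Z) \<le> card (menu M)"
    using ex_has_greatest_nat[of "\<lambda>Z. settled Z \<and> P Z" X "\<lambda>Z. card (menu Z)"] ex
    by (metis le_imp_less_Suc)
  show thesis
  proof (rule that[of M])
    fix Z assume "settled Z" "P Z" "menu M \<subseteq> menu Z"
    then show "menu Z = menu M" using card_seteq[OF finite_menu] max by metis
  qed (use M in blast)+
qed

text \<open>
  A settled \<open>X\<close> that is maximal with \<open>passed X \<subseteq> I\<close> absorbs, by taking joins, every \<open>M\<close> with
  \<open>passed M \<subseteq> I\<close>.
\<close>
lemma passed_surj:
  assumes I: "I \<subseteq> labels"
    and closed: "\<And>L. L \<in> I \<Longrightarrow> \<exists>M. settled M \<and> L \<in> passed M \<and> passed M \<subseteq> I"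
    and bot: "settled B" "passed B = {}"
  obtains X where "settled X" "passed X = I"
proof -
  obtain X where X: "settled X" "passed X \<subseteq> I"
    and max: "\<And>Z. settled Z \<Longrightarrow> passed Z \<subseteq> I \<Longrightarrow> menu X \<subseteq> menu Z \<Longrightarrow> menu Z = menu X"
    using greatest_settled[of B "\<lambda>Z. passed Z \<subseteq> I"] bot by auto
  have "L \<in> passed X" if LI: "L \<in> I" for L
  proof -
    obtain M where M: "settled M" "L \<in> passed M" "passed M \<subseteq> I" using closed[OF LI] by blast
    obtain N where N: "settled N" "menu N = menu X \<union> menu M" using settled_join[OF X(1) M(1)] .
    have "passed N = passed X \<union> passed M" using passed_join[OF X(1) M(1) N(2)] .
    then have "menu N = menu X" using max[OF N(1)] X(2) M(3) N(2) by auto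
    then have "passed M \<subseteq> passed X" using N(2) by (intro passed_mono) auto
    then show ?thesis using M(2) by blast
  qed
  then show thesis using that[of X] X by blast
qed

end

section \<open>Orders represented by rings of sets\<close>

text \<open>
  Both lattices of the theorem have this form: the stable matchings by way of their menus, the
  ideals as they are.
\<close>
locale ring_of_sets_order =
  fixes C :: "'a set" and below :: "'a \<Rightarrow> 'a \<Rightarrow> bool" and h :: "'a \<Rightarrow> 'b set"
  assumes below_iff: "x \<in> C \<Longrightarrow> y \<in> C \<Longrightarrow> below x y \<longleftrightarrow> h x \<subseteq> h y"
    and inj: "inj_on h C"
    and union: "x \<in> C \<Longrightarrow> y \<in> C \<Longrightarrow> \<exists>s\<in>C. h s = h x \<union> h y"
    and inter: "x \<in> C \<Longrightarrow> y \<in> C \<Longrightarrow> \<exists>i\<in>C. h i = h x \<inter> h y"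
begin

abbreviation ord :: "'a gorder" where
  "ord \<equiv> \<lparr>carrier = C, eq = (=), le = below\<rparr>"

lemma partial_order: "partial_order ord"
  by unfold_locales (auto simp: below_iff dest: inj_onD[OF inj])

lemma is_lubI:
  assumes "x \<in> C" "y \<in> C" "s \<in> C" "h s = h x \<union> h y"
  shows "is_lub ord s {x, y}"
proof (rule least_UpperI)
  fix z assume z: "z \<in> Upper ord {x, y}"
  then have zC: "z \<in> C" and "below x z" "below y z" using assms by (simp_all add: Upper_def)
  then have "h x \<subseteq> h z" "h y \<subseteq> h z" using assms below_iff by simp_all
  then show "s \<sqsubseteq>\<^bsub>ord\<^esub> z" using assms zC below_iff by simp
qed (use assms below_iff in auto)

lemma is_glbI:
  assumes "x \<in> C" "y \<in> C" "i \<in> C" "h i = h x \<inter> h y"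
  shows "is_glb ord i {x, y}"
proof (rule greatest_LowerI)
  fix z assume z: "z \<in> Lower ord {x, y}"
  then have zC: "z \<in> C" and "below z x" "below z y" using assms by (simp_all add: Lower_def)
  then have "h z \<subseteq> h x" "h z \<subseteq> h y" using assms below_iff by simp_all
  then show "z \<sqsubseteq>\<^bsub>ord\<^esub> i" using assms zC below_iff by simp
qed (use assms below_iff in auto)

lemma lattice: "lattice ord"
proof -
  interpret partial_order ord by (rule partial_order)
  show ?thesis
  proof
    fix x y assume "x \<in> carrier ord" "y \<in> carrier ord"
    then have xy: "x \<in> C" "y \<in> C" by simp_all
    show "\<exists>s. is_lub ord s {x, y}" using union[OF xy] is_lubI[OF xy] by blast
    show "\<exists>i. is_glb ord i {x, y}" using inter[OF xy] is_glbI[OF xy] by blast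
  qed
qed

lemma join_eq:
  assumes "x \<in> C" "y \<in> C" "s \<in> C" "h s = h x \<union> h y"
  shows "join ord x y = s"
proof -
  interpret lattice ord by (rule lattice)
  have "is_lub ord (join ord x y) {x, y}"
    unfolding join_def sup_def by (rule someI[of _ s]) (rule is_lubI[OF assms])
  then show ?thesis using least_unique[OF _ is_lubI[OF assms]] by blast
qed

lemma meet_eq:
  assumes "x \<in> C" "y \<in> C" "i \<in> C" "h i = h x \<inter> h y"
  shows "meet ord x y = i"
proof -
  interpret lattice ord by (rule lattice)
  have "is_glb ord (meet ord x y) {x, y}"
    unfolding meet_def inf_def by (rule someI[of _ i]) (rule is_glbI[OF assms])
  then show ?thesis using greatest_unique[OF _ is_glbI[OF assms]] by blast
qed

end

lemma ring_of_sets_isomorphism: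
  assumes "ring_of_sets_order C r h" "ring_of_sets_order C' r' h'"
    and bij: "bij_betw f C C'"
    and mono: "\<And>x y. x \<in> C \<Longrightarrow> y \<in> C \<Longrightarrow> h' (f x) \<subseteq> h' (f y) \<longleftrightarrow> h x \<subseteq> h y"
    and union: "\<And>x y s. x \<in> C \<Longrightarrow> y \<in> C \<Longrightarrow> s \<in> C \<Longrightarrow> h s = h x \<union> h y \<Longrightarrow> h' (f s) = h' (f x) \<union> h' (f y)"
    and inter: "\<And>x y i. x \<in> C \<Longrightarrow> y \<in> C \<Longrightarrow> i \<in> C \<Longrightarrow> h i = h x \<inter> h y \<Longrightarrow> h' (f i) = h' (f x) \<inter> h' (f y)"
  shows "lattice_isomorphism \<lparr>carrier = C, eq = (=), le = r\<rparr> \<lparr>carrier = C', eq = (=), le = r'\<rparr> f"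
proof -
  interpret A: ring_of_sets_order C r h by fact
  interpret B: ring_of_sets_order C' r' h' by fact
  have f: "f x \<in> C'" if "x \<in> C" for x using that bij bij_betwE by blast
  interpret PA: partial_order A.ord by (rule A.partial_order)
  interpret PB: partial_order B.ord by (rule B.partial_order)
  have "order_emb A.ord B.ord f"
    unfolding order_emb_def
    using PA.weak_partial_order_axioms PB.weak_partial_order_axioms f mono
    by (simp add: A.below_iff B.below_iff)
  moreover have "f (join A.ord x y) = join B.ord (f x) (f y)" if xy: "x \<in> C" "y \<in> C" for x y
  proof -
    obtain s where s: "s \<in> C" "h s = h x \<union> h y" using A.union xy by blast
    show ?thesis
      using A.join_eq[OF xy s] B.join_eq[OF f[OF xy(1)] f[OF xy(2)] f[OF s(1)]]
        union[OF xy s] by simp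
  qed
  moreover have "f (meet A.ord x y) = meet B.ord (f x) (f y)" if xy: "x \<in> C" "y \<in> C" for x y
  proof -
    obtain i where i: "i \<in> C" "h i = h x \<inter> h y" using A.inter xy by blast
    show ?thesis
      using A.meet_eq[OF xy i] B.meet_eq[OF f[OF xy(1)] f[OF xy(2)] f[OF i(1)]]
        inter[OF xy i] by simp
  qed
  ultimately show ?thesis
    unfolding lattice_isomorphism_def join_pres_def meet_pres_def
    using A.lattice B.lattice bij by simp
qed

section \<open>The market as a ranked choice\<close>

context choice_market
begin

text \<open>
  The conjunct \<open>e \<in> E\<close> matters because \<open>pref\<close> is unrestricted outside \<open>W\<close>.
\<close>
definition outranks :: "'w \<times> 'f \<Rightarrow> 'w \<times> 'f \<Rightarrow> bool" where
  "outranks e e' \<longleftrightarrow> e \<in> E \<and> (e, e') \<in> pref (fst e)"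

definition choice :: "('w \<times> 'f) set \<Rightarrow> ('w \<times> 'f) set" where
  "choice Z = (\<Union>f\<in>F. CF f (at_F Z f))"

lemma finite_edges: "finite E"
  by (rule finite_subset[OF edges]) (simp add: finite_W finite_F)

lemma fst_edge: "e \<in> E \<Longrightarrow> fst e \<in> W" and snd_edge: "e \<in> E \<Longrightarrow> snd e \<in> F"
  using edges by auto

lemma outranks_mem:
  assumes "outranks e e'"
  shows "e \<in> E \<and> e' \<in> E \<and> fst e' = fst e"
proof -
  have "e \<in> E" "(e, e') \<in> pref (fst e)" using assms by (auto simp: outranks_def)
  then have "(e, e') \<in> {d \<in> E. fst d = fst e} \<times> {d \<in> E. fst d = fst e}"
    using pref_field[OF fst_edge] by blast
  then show ?thesis by simp
qed

lemma at_F_subset: "at_F Z f \<subseteq> {e \<in> E. snd e = f}"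
  by (auto simp: at_F_def)

lemma at_F_mono: "Z' \<subseteq> Z \<Longrightarrow> at_F Z' f \<subseteq> at_F Z f"
  by (auto simp: at_F_def)

lemma CF_at_F: "f \<in> F \<Longrightarrow> CF f (at_F Z f) \<subseteq> at_F Z f"
  using CF_subset at_F_subset by blast

lemma mem_at_F: "e \<in> at_F Z f \<longleftrightarrow> e \<in> Z \<and> e \<in> E \<and> snd e = f"
  by (simp add: at_F_def)

lemma mem_choice: "e \<in> choice Z \<longleftrightarrow> e \<in> E \<and> e \<in> CF (snd e) (at_F Z (snd e))"
proof
  assume "e \<in> choice Z"
  then obtain f where f: "f \<in> F" "e \<in> CF f (at_F Z f)" by (auto simp: choice_def)
  then have "e \<in> at_F Z f" using CF_at_F by blast
  then show "e \<in> E \<and> e \<in> CF (snd e) (at_F Z (snd e))" using f by (simp add: mem_at_F)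
next
  assume e: "e \<in> E \<and> e \<in> CF (snd e) (at_F Z (snd e))"
  then have "snd e \<in> F" using snd_edge by blast
  then show "e \<in> choice Z" using e unfolding choice_def by blast
qed

lemma choice_subset: "choice Z \<subseteq> Z \<inter> E"
proof
  fix e assume "e \<in> choice Z"
  then have "e \<in> E" "e \<in> CF (snd e) (at_F Z (snd e))" by (simp_all add: mem_choice)
  then have "e \<in> at_F Z (snd e)" using CF_at_F snd_edge by blast
  then show "e \<in> Z \<inter> E" by (simp add: mem_at_F)
qed

lemma choice_at:
  assumes "f \<in> F"
  shows "at_F (choice Z) f = CF f (at_F Z f)"
proof (rule Set.set_eqI)
  fix e
  show "e \<in> at_F (choice Z) f \<longleftrightarrow> e \<in> CF f (at_F Z f)"
  proof
    assume "e \<in> CF f (at_F Z f)"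
    moreover from this have "e \<in> at_F Z f" using CF_at_F assms by blast
    ultimately show "e \<in> at_F (choice Z) f" by (simp add: mem_at_F mem_choice)
  qed (auto simp: mem_at_F mem_choice)
qed

lemma eq_by_at_F:
  assumes "Z \<subseteq> E" "Z' \<subseteq> E" "\<And>f. f \<in> F \<Longrightarrow> at_F Z f = at_F Z' f"
  shows "Z = Z'"
proof (rule Set.set_eqI)
  fix e
  show "e \<in> Z \<longleftrightarrow> e \<in> Z'"
    using assms(1,2) assms(3)[of "snd e"] snd_edge[of e] mem_at_F[of e _ "snd e"] by blast
qed

sublocale ranked: ranked_choice E fst outranks choice
proof
  show "finite E" by (rule finite_edges)
  show "\<And>e e'. outranks e e' \<Longrightarrow> e \<in> E \<and> e' \<in> E \<and> fst e' = fst e" by (rule outranks_mem)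
  show "\<not> outranks e e" for e
  proof
    assume "outranks e e"
    then have "e \<in> E" "(e, e) \<in> pref (fst e)" by (auto simp: outranks_def)
    then show False
      using pref_linear[OF fst_edge] unfolding strict_linear_order_on_def irrefl_on_def by blast
  qed
  show "outranks e e''" if "outranks e e'" "outranks e' e''" for e e' e''
  proof -
    have e: "e \<in> E" "fst e' = fst e" using outranks_mem[OF that(1)] by auto
    have "trans (pref (fst e))"
      using pref_linear[OF fst_edge[OF e(1)]] by (simp add: strict_linear_order_on_def)
    then show ?thesis using that e unfolding outranks_def by (metis transD)
  qed
  show "outranks e e' \<or> outranks e' e" if "e \<in> E" "e' \<in> E" "fst e = fst e'" "e \<noteq> e'" for e e'
  proof -
    have "total_on {d \<in> E. fst d = fst e} (pref (fst e))"
      using pref_linear[OF fst_edge[OF that(1)]] by (simp add: strict_linear_order_on_def)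
    then have "(e, e') \<in> pref (fst e) \<or> (e', e) \<in> pref (fst e)"
      using that unfolding total_on_def by (metis (mono_tags, lifting) mem_Collect_eq)
    then show ?thesis using that by (simp add: outranks_def)
  qed
  show "\<And>Z. choice Z \<subseteq> Z \<inter> E" by (rule choice_subset)
  show "choice Z' = choice Z" if "choice Z \<subseteq> Z'" "Z' \<subseteq> Z" for Z Z'
  proof -
    have "CF f (at_F Z' f) = CF f (at_F Z f)" if f: "f \<in> F" for f
    proof (rule CF_consistent[OF f at_F_subset at_F_mono[OF \<open>Z' \<subseteq> Z\<close>]])
      show "CF f (at_F Z f) \<subseteq> at_F Z' f"
        using at_F_mono[OF \<open>choice Z \<subseteq> Z'\<close>, of f] choice_at[OF f] by simp
    qed
    then show ?thesis by (simp add: choice_def)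
  qed
  show "e \<in> choice Z'" if "e \<in> choice Z" "Z' \<subseteq> Z" "e \<in> Z'" for e Z Z'
  proof -
    have e: "e \<in> E" using that(1) by (simp add: mem_choice)
    have "CF (snd e) (at_F Z (snd e)) \<inter> at_F Z' (snd e) \<subseteq> CF (snd e) (at_F Z' (snd e))"
      by (rule CF_substitutable[OF snd_edge[OF e] at_F_subset at_F_mono[OF that(2)]])
    then show ?thesis
      using that(1,3) e unfolding mem_choice by (auto simp: mem_at_F)
  qed
  have card_choice: "card (choice Z) = (\<Sum>f\<in>F. card (CF f (at_F Z f)))" for Z
    unfolding choice_def
  proof (rule card_UN_disjoint[OF finite_F])
    have sub: "CF g (at_F Z g) \<subseteq> {e \<in> E. snd e = g}" if "g \<in> F" for g
      using CF_at_F[OF that] at_F_subset by blast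
    then show "\<forall>f\<in>F. finite (CF f (at_F Z f))"
      using finite_subset[OF _ finite_edges] by blast
    show "\<forall>f\<in>F. \<forall>g\<in>F. f \<noteq> g \<longrightarrow> CF f (at_F Z f) \<inter> CF g (at_F Z g) = {}"
      using sub by blast
  qed
  show "card (choice Z') \<le> card (choice Z)" if "Z' \<subseteq> Z" for Z Z'
    unfolding card_choice by (intro sum_mono CF_card_mono at_F_subset at_F_mono that)
qed

text \<open>
  An edge blocks \<open>X\<close> iff it is a new edge on the menu of \<open>X\<close> that is chosen when added to \<open>X\<close>. If
  there is none, substitutability excludes all new edges from the choice from the whole menu.
\<close>
lemma stable_iff_settled: "stable X \<longleftrightarrow> ranked.settled X"
proof
  assume st: "stable X"
  then have XE: "X \<subseteq> E" and accW: "\<And>w. w \<in> W \<Longrightarrow> CW w (at_W X w) = at_W X w"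
    and accF: "\<And>f. f \<in> F \<Longrightarrow> CF f (at_F X f) = at_F X f"
    by (auto simp: stable_def acceptable_def)
  have uniq: "x = y" if "x \<in> X" "y \<in> X" "fst x = fst y" for x y
  proof (rule ccontr)
    assume "x \<noteq> y"
    have xE: "x \<in> E" using that XE by blast
    have "x \<in> at_W X (fst x)" "y \<in> at_W X (fst x)"
      using that XE by (auto simp: at_W_def)
    then have "x \<in> CW (fst x) (at_W X (fst x))" "y \<in> CW (fst x) (at_W X (fst x))"
      "x \<in> at_W X (fst x)" "y \<in> at_W X (fst x)"
      using accW[OF fst_edge[OF xE]] by simp_all
    then have "(x, y) \<in> pref (fst x)" "(y, x) \<in> pref (fst x)"
      using \<open>x \<noteq> y\<close> unfolding CW_def by blast+
    then have "outranks x y" "outranks y x"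
      using XE that by (auto simp: outranks_def)
    then show False using ranked.beats_asym by blast
  qed
  have cX: "choice X = X"
  proof (rule eq_by_at_F[OF _ XE])
    show "choice X \<subseteq> E" using choice_subset by blast
    show "at_F (choice X) f = at_F X f" if "f \<in> F" for f
      using choice_at[OF that] accF[OF that] by simp
  qed
  have Xm: "X \<subseteq> ranked.menu X"
  proof
    fix e assume e: "e \<in> X"
    have "\<not> outranks x e" if x: "x \<in> X" for x
    proof
      assume b: "outranks x e"
      then have "e = x" using uniq[OF e x] outranks_mem[OF b] by blast
      then show False using b ranked.beats_irrefl by blast
    qed
    then show "e \<in> ranked.menu X" using e XE by (auto simp: ranked.menu_def)
  qed
  have "choice (ranked.menu X) \<subseteq> X"
  proof (rule subsetI, rule ccontr)
    fix e assume e: "e \<in> choice (ranked.menu X)" and eX: "e \<notin> X"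
    have em: "e \<in> ranked.menu X" and eE: "e \<in> E" using e choice_subset by blast+
    have ec: "e \<in> choice (insert e X)"
      by (rule ranked.chosen_substitutable[OF e]) (use em Xm in auto)
    have "(e, x) \<in> pref (fst e)" if "x \<in> at_W X (fst e)" for x
    proof -
      have x: "x \<in> X" "x \<in> E" "fst x = fst e" using that by (auto simp: at_W_def)
      then have "\<not> outranks x e" using em by (simp add: ranked.menu_def)
      then have "outranks e x" using ranked.beats_total[OF eE x(2)] x eX by auto
      then show ?thesis by (simp add: outranks_def)
    qed
    then have "e \<in> CW (fst e) (at_W X (fst e) \<union> {e})" by (auto simp: CW_def)
    moreover have "at_F (insert e X) (snd e) = at_F X (snd e) \<union> {e}"
      using eE by (auto simp: at_F_def)
    then have "e \<in> CF (snd e) (at_F X (snd e) \<union> {e})"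
      using ec unfolding mem_choice by simp
    moreover have "(fst e, snd e) = e" by simp
    ultimately show False
      using st eE eX unfolding stable_def by (metis DiffI)
  qed
  then show "ranked.settled X"
    using ranked.chosen_consistent[OF _ Xm] cX by (simp add: ranked.settled_def)
next
  assume X: "ranked.settled X"
  note XE = ranked.settled_E[OF X] and Xm = ranked.settled_menu[OF X]
  have "CW w (at_W X w) = at_W X w" for w
  proof
    show "at_W X w \<subseteq> CW w (at_W X w)"
      using ranked.settled_unique[OF X] by (auto simp: CW_def at_W_def)
  qed (auto simp: CW_def)
  moreover have "CF f (at_F X f) = at_F X f" if "f \<in> F" for f
    using choice_at[OF that, of X] ranked.settled_fixed[OF X] by simp
  moreover have False
    if e: "e \<in> E - X" "e \<in> CW w (at_W X w \<union> {e})" "e \<in> CF f (at_F X f \<union> {e})"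
      and wf: "e = (w, f)" for e w f
  proof -
    have "\<not> outranks x e" if x: "x \<in> X" for x
    proof
      assume b: "outranks x e"
      then have "x \<in> at_W X w" using x outranks_mem[OF b] wf by (simp add: at_W_def)
      then have "(e, x) \<in> pref w" using e x by (auto simp: CW_def)
      then have "outranks e x" using e wf by (simp add: outranks_def)
      then show False using b ranked.beats_asym by blast
    qed
    then have em: "e \<in> ranked.menu X" using e by (simp add: ranked.menu_def)
    have "at_F (insert e X) f = at_F X f \<union> {e}"
      using e(1) wf by (auto simp: at_F_def)
    then have "e \<in> choice (insert e X)"
      using e wf unfolding mem_choice by simp
    moreover have "choice (insert e X) = X"
      by (rule ranked.settled_between[OF X]) (use em Xm in auto)
    ultimately show False using e(1) by simp
  qed
  ultimately show "stable X"
    unfolding stable_def acceptable_def using XE by blast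
qed

text \<open>
  The interests of the two sides are opposed. If \<open>F\<close> prefers \<open>Y\<close> and an edge of the menu of \<open>X\<close> were
  not on that of \<open>Y\<close>, then the better edge \<open>y \<in> Y\<close> of the same agent would be on the menu of \<open>X\<close> and
  would be chosen when added to \<open>X\<close>; so it would lie in \<open>X\<close>, above the given edge.
\<close>
lemma prefers_F_iff:
  assumes X: "stable X" and Y: "stable Y"
  shows "X = Y \<or> prefers_F Y X \<longleftrightarrow> ranked.menu X \<subseteq> ranked.menu Y"
proof -
  note sX = X[unfolded stable_iff_settled] and sY = Y[unfolded stable_iff_settled]
  have at_Un: "at_F Y f \<union> at_F X f = at_F (Y \<union> X) f" for f by (auto simp: at_F_def)
  have "(\<forall>f\<in>F. CF f (at_F Y f \<union> at_F X f) = at_F Y f) \<longleftrightarrow> choice (Y \<union> X) = Y"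
    (is "?l \<longleftrightarrow> ?r")
  proof
    assume l: ?l
    show ?r
    proof (rule eq_by_at_F[OF _ ranked.settled_E[OF sY]])
      show "choice (Y \<union> X) \<subseteq> E" using choice_subset by blast
      show "at_F (choice (Y \<union> X)) f = at_F Y f" if "f \<in> F" for f
        using l that by (simp add: choice_at at_Un)
    qed
  next
    assume r: ?r
    show ?l
    proof
      fix f assume "f \<in> F"
      then show "CF f (at_F Y f \<union> at_F X f) = at_F Y f"
        using choice_at[of f "Y \<union> X"] r unfolding at_Un by simp
    qed
  qed
  then have "prefers_F Y X \<longleftrightarrow> X \<noteq> Y \<and> choice (Y \<union> X) = Y"
    using X Y by (auto simp: prefers_F_def stable_def)
  moreover have "ranked.menu X \<subseteq> ranked.menu Y" if "choice (Y \<union> X) = Y"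
  proof (rule subsetI, rule ccontr)
    fix e assume e: "e \<in> ranked.menu X" "e \<notin> ranked.menu Y"
    obtain y where y: "y \<in> Y" "outranks y e"
      using ranked.not_menuE e ranked.menu_E by blast
    have yX: "y \<in> ranked.menu X" using ranked.menu_upward[OF e(1) y(2)] .
    have "y \<in> choice (insert y X)"
      using ranked.chosen_substitutable[of y "Y \<union> X" "insert y X"] that y(1) by auto
    moreover have "choice (insert y X) = X"
      by (rule ranked.settled_between[OF sX]) (use yX ranked.settled_menu[OF sX] in auto)
    ultimately have "y \<in> X" by simp
    then show False using e(1) y(2) by (simp add: ranked.menu_def)
  qed
  moreover have "choice (Y \<union> X) = Y" if "ranked.menu X \<subseteq> ranked.menu Y"
    by (rule ranked.settled_between[OF sY])
      (use that ranked.settled_menu[OF sX] ranked.settled_menu[OF sY] in auto)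
  ultimately show ?thesis by blast
qed

section \<open>The active graph contains every cycle of tandems\<close>

lemma W_candidates_eq:
  assumes "ranked.settled X"
  shows "W_candidates X w = ranked.candidates X w"
proof (rule Set.set_eqI)
  fix e
  have "(\<exists>x. at_W X w = {x} \<and> (x, e) \<in> pref w) \<longleftrightarrow> (\<exists>x\<in>X. outranks x e)"
    if e: "e \<in> E" "fst e = w"
  proof
    assume "\<exists>x. at_W X w = {x} \<and> (x, e) \<in> pref w"
    then obtain x where x: "x \<in> at_W X w" "(x, e) \<in> pref w" by auto
    then have "x \<in> X" "outranks x e" by (auto simp: at_W_def outranks_def)
    then show "\<exists>x\<in>X. outranks x e" by blast
  next
    assume "\<exists>x\<in>X. outranks x e"
    then obtain x where x: "x \<in> X" "outranks x e" by blast
    then have "x \<in> at_W X w" "(x, e) \<in> pref w"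
      using outranks_mem[OF x(2)] e by (auto simp: at_W_def outranks_def)
    moreover have "y = x" if "y \<in> at_W X w" for y
      using ranked.settled_unique[OF assms] that calculation(1) by (auto simp: at_W_def)
    ultimately show "\<exists>x. at_W X w = {x} \<and> (x, e) \<in> pref w" by blast
  qed
  moreover have "at_F (insert e X) (snd e) = at_F X (snd e) \<union> {e}" if "e \<in> E"
    using that by (auto simp: at_F_def)
  ultimately show "e \<in> W_candidates X w \<longleftrightarrow> e \<in> ranked.candidates X w"
    by (auto simp: W_candidates_def ranked.candidates_def mem_choice)
qed

lemma mem_W_admissible:
  assumes "ranked.settled X"
  shows "a \<in> W_admissible X \<longleftrightarrow> ranked.admissible X a"
proof -
  have "a \<in> CW w (ranked.candidates X w) \<longleftrightarrow> fst a = w \<and> ranked.admissible X a" for w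
  proof -
    have "a \<in> ranked.candidates X w \<Longrightarrow> a \<in> E \<and> fst a = w"
      by (simp add: ranked.candidates_def)
    then show ?thesis
      by (auto simp: CW_def ranked.admissible_def outranks_def)
  qed
  moreover have "ranked.admissible X a \<Longrightarrow> fst a \<in> W"
    using fst_edge by (auto simp: ranked.admissible_def ranked.candidates_def)
  ultimately show ?thesis
    by (auto simp: W_admissible_def W_candidates_eq[OF assms])
qed

text \<open>
  Only \<open>C\<^sub>f\<close> for the end \<open>f\<close> of \<open>a\<close> sees the additional edge. Conversely, an edge \<open>b\<close> that disappears
  must have this end \<open>f\<close>, because the choice does not change at the other vertices.
\<close>
lemma mem_tandems:
  assumes X: "ranked.settled X"
  shows "(a, b) \<in> tandems X \<longleftrightarrow> ranked.tandem X a b"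
proof -
  have "b \<in> at_F X (snd a) \<and>
      CF (snd a) (at_F X (snd a) \<union> {a}) = (at_F X (snd a) - {b}) \<union> {a}
    \<longleftrightarrow> b \<in> X \<and> choice (insert a X) = insert a (X - {b})" (is "?l \<longleftrightarrow> ?r")
    if a: "ranked.admissible X a"
  proof -
    have aE: "a \<in> E" using ranked.admissibleD[OF a] by blast
    have aX: "a \<notin> X" using ranked.admissible_notin[OF X a] .
    have XE: "X \<subseteq> E" using ranked.settled_E[OF X] .
    have here: "at_F (insert a X) (snd a) = at_F X (snd a) \<union> {a}"
      using aE by (auto simp: at_F_def)
    have away: "at_F (insert a X) f = at_F X f" if "f \<noteq> snd a" for f
      using that by (auto simp: at_F_def)
    have cX: "CF f (at_F X f) = at_F X f" if "f \<in> F" for f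
      using choice_at[OF that, of X] ranked.settled_fixed[OF X] by simp
    have at_r: "at_F (insert a (X - {b})) f =
        (if f = snd a then (at_F X f - {b}) \<union> {a} else at_F X f - {b})" for f
      using aE by (auto simp: at_F_def)
    show ?thesis
    proof
      assume l: ?l
      have "choice (insert a X) = insert a (X - {b})"
      proof (rule eq_by_at_F)
        show "choice (insert a X) \<subseteq> E" using choice_subset by blast
        show "insert a (X - {b}) \<subseteq> E" using aE XE by blast
        fix f assume f: "f \<in> F"
        have "b \<notin> at_F X f" if "f \<noteq> snd a" using l that by (auto simp: at_F_def)
        then show "at_F (choice (insert a X)) f = at_F (insert a (X - {b})) f"
          unfolding choice_at[OF f] at_r using l here away cX[OF f] by auto
      qed
      then show ?r using l by (simp add: mem_at_F)
    next
      assume r: ?r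
      have bE: "b \<in> E" using r XE by blast
      have ba: "snd b = snd a"
      proof (rule ccontr)
        assume ne: "snd b \<noteq> snd a"
        have "b \<in> CF (snd b) (at_F (insert a X) (snd b))"
          using away[OF ne] cX[OF snd_edge[OF bE]] r bE by (simp add: mem_at_F)
        then have "b \<in> choice (insert a X)" using bE by (simp add: mem_choice)
        then show False using r aX by auto
      qed
      have "CF (snd a) (at_F X (snd a) \<union> {a}) = at_F (choice (insert a X)) (snd a)"
        using choice_at[OF snd_edge[OF aE], of "insert a X"] here by simp
      also have "\<dots> = (at_F X (snd a) - {b}) \<union> {a}" using r at_r by simp
      finally show ?l using r ba bE by (simp add: mem_at_F)
    qed
  qed
  then show ?thesis
    using mem_W_admissible[OF X, of a] by (auto simp: tandems_def ranked.tandem_def)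
qed

text \<open>
  The edges directed from \<open>F\<close> to \<open>W\<close> that are left in the graph when \<open>A\<close> is the set of remaining
  edges directed from \<open>W\<close> to \<open>F\<close>; every cleaning step preserves this dependence.
\<close>
definition targets :: "('w \<times> 'f) set \<Rightarrow> ('w \<times> 'f) set \<Rightarrow> ('w \<times> 'f) set" where
  "targets X A = {b. \<exists>a\<in>A. (a, b) \<in> tandems X}"

text \<open>
  The sets in which no edge is ready to be deleted. They are closed under union, so there is a
  largest one, and it is where the cleaning procedure ends, in whatever order it is carried out.
\<close>
definition self_fed :: "('w \<times> 'f) set \<Rightarrow> ('w \<times> 'f) set \<Rightarrow> bool" where
  "self_fed X A \<longleftrightarrow> A \<subseteq> W_admissible X \<and> (\<forall>a\<in>A. \<exists>b\<in>targets X A. fst b = fst a)"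

definition largest_self_fed :: "('w \<times> 'f) set \<Rightarrow> ('w \<times> 'f) set" where
  "largest_self_fed X = \<Union>{A. self_fed X A}"

lemma targets_mono: "A \<subseteq> A' \<Longrightarrow> targets X A \<subseteq> targets X A'"
  by (auto simp: targets_def)

lemma self_fed_largest: "self_fed X (largest_self_fed X)"
proof -
  have "\<exists>b\<in>targets X (largest_self_fed X). fst b = fst a" if a: "a \<in> largest_self_fed X" for a
  proof -
    obtain A where A: "self_fed X A" "a \<in> A" using a by (auto simp: largest_self_fed_def)
    then obtain b where b: "b \<in> targets X A" "fst b = fst a" by (auto simp: self_fed_def)
    have "A \<subseteq> largest_self_fed X" using A by (auto simp: largest_self_fed_def)
    then show ?thesis using b targets_mono by blast
  qed
  moreover have "largest_self_fed X \<subseteq> W_admissible X"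
    by (auto simp: largest_self_fed_def self_fed_def)
  ultimately show ?thesis by (simp add: self_fed_def)
qed

lemma F_admissible_eq: "F_admissible X = targets X (W_admissible X)"
proof (rule Set.set_eqI)
  fix b
  have "a \<in> W_admissible X" if "(a, b) \<in> tandems X" for a
    using that by (simp add: tandems_def)
  moreover have "b \<in> F_admissible X \<longleftrightarrow> (\<exists>a. (a, b) \<in> tandems X)"
    by (simp only: F_admissible_def snd_eq_Range Range_iff)
  ultimately show "b \<in> F_admissible X \<longleftrightarrow> b \<in> targets X (W_admissible X)"
    unfolding targets_def by blast
qed

lemma cleaning_step_iff:
  "cleaning_step X (A, targets X A) G \<longleftrightarrow>
     (\<exists>a\<in>A. \<not> (\<exists>b\<in>targets X A. fst b = fst a) \<and> G = (A - {a}, targets X (A - {a})))"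
proof -
  have key: "targets X A - {b. (a, b) \<in> tandems X \<and> \<not> (\<exists>a'\<in>A. a' \<noteq> a \<and> (a', b) \<in> tandems X)}
      = targets X (A - {a})" for a
    unfolding targets_def by blast
  show ?thesis
  proof
    assume "cleaning_step X (A, targets X A) G"
    then obtain a where "a \<in> A" "\<not> (\<exists>b\<in>targets X A. fst b = fst a)"
      "G = (A - {a}, targets X (A - {a}))"
      by (rule cleaning_step.cases) (use key in blast)
    then show "\<exists>a\<in>A. \<not> (\<exists>b\<in>targets X A. fst b = fst a) \<and> G = (A - {a}, targets X (A - {a}))"
      by blast
  next
    assume "\<exists>a\<in>A. \<not> (\<exists>b\<in>targets X A. fst b = fst a) \<and> G = (A - {a}, targets X (A - {a}))"
    then obtain a where a: "a \<in> A" "\<not> (\<exists>b\<in>targets X A. fst b = fst a)"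
      "G = (A - {a}, targets X (A - {a}))" by blast
    show "cleaning_step X (A, targets X A) G"
      using cleaning_step.intros[OF a(1,2), of X] unfolding key a(3) .
  qed
qed

text \<open>
  No edge of the largest self-fed set is ever deleted, since the edges entering its agents
  remain.
\<close>
lemma cleaning_invariant:
  assumes "(cleaning_step X)\<^sup>*\<^sup>* (W_admissible X, F_admissible X) G"
  obtains A where "G = (A, targets X A)" "largest_self_fed X \<subseteq> A" "A \<subseteq> W_admissible X"
proof -
  have "\<exists>A. G = (A, targets X A) \<and> largest_self_fed X \<subseteq> A \<and> A \<subseteq> W_admissible X"
    using assms
  proof (induction rule: rtranclp_induct)
    case base
    show ?case
      using F_admissible_eq[of X] self_fed_largest[of X] unfolding self_fed_def by blast
  next
    case (step G G')
    then obtain A where A: "G = (A, targets X A)" "largest_self_fed X \<subseteq> A" "A \<subseteq> W_admissible X"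
      by blast
    have "cleaning_step X (A, targets X A) G'" using step.hyps(2) A(1) by simp
    then obtain a where a: "\<not> (\<exists>b\<in>targets X A. fst b = fst a)" "G' = (A - {a}, targets X (A - {a}))"
      unfolding cleaning_step_iff by blast
    have "a \<notin> largest_self_fed X"
      using self_fed_largest[of X] a(1) targets_mono[OF A(2)] unfolding self_fed_def by blast
    then show ?case using A a(2) by blast
  qed
  then show thesis using that by blast
qed

lemma cleaning_terminates:
  assumes "finite A"
  shows "\<exists>A'. (cleaning_step X)\<^sup>*\<^sup>* (A, targets X A) (A', targets X A')
    \<and> \<not> (\<exists>G. cleaning_step X (A', targets X A') G)"
  using assms
proof (induction A rule: finite_psubset_induct)
  case (psubset A)
  show ?case
  proof (cases "\<exists>G. cleaning_step X (A, targets X A) G")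
    case True
    then obtain a where a: "a \<in> A" "\<not> (\<exists>b\<in>targets X A. fst b = fst a)"
      unfolding cleaning_step_iff by blast
    then have step: "cleaning_step X (A, targets X A) (A - {a}, targets X (A - {a}))"
      unfolding cleaning_step_iff by blast
    have "A - {a} \<subset> A" using a(1) by blast
    from psubset.IH[OF this] show ?thesis using step by (meson converse_rtranclp_into_rtranclp)
  next
    case False
    then show ?thesis by blast
  qed
qed

lemma active_graph_eq: "active_graph X = (largest_self_fed X, targets X (largest_self_fed X))"
  unfolding active_graph_def
proof (rule the_equality)
  have final: "G = (largest_self_fed X, targets X (largest_self_fed X))"
    if G: "(cleaning_step X)\<^sup>*\<^sup>* (W_admissible X, F_admissible X) G"
      "\<not> (\<exists>G'. cleaning_step X G G')" for G
  proof -
    obtain A where A: "G = (A, targets X A)" "largest_self_fed X \<subseteq> A" "A \<subseteq> W_admissible X"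
      using cleaning_invariant[OF G(1)] .
    then have "self_fed X A"
      using G(2) unfolding A(1) cleaning_step_iff self_fed_def by blast
    then have "A \<subseteq> largest_self_fed X" by (auto simp: largest_self_fed_def)
    then show ?thesis using A by auto
  qed
  then show "G = (largest_self_fed X, targets X (largest_self_fed X))"
    if "(cleaning_step X)\<^sup>*\<^sup>* (W_admissible X, F_admissible X) G
      \<and> \<not> (\<exists>G'. cleaning_step X G G')" for G
    using that by blast
  have "W_admissible X \<subseteq> E"
    by (auto simp: W_admissible_def CW_def W_candidates_def)
  then have "finite (W_admissible X)" using finite_edges finite_subset by blast
  then obtain G where "(cleaning_step X)\<^sup>*\<^sup>* (W_admissible X, F_admissible X) G"
      "\<not> (\<exists>G'. cleaning_step X G G')"
    using cleaning_terminates[of "W_admissible X" X] unfolding F_admissible_eq by blast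
  then show "(cleaning_step X)\<^sup>*\<^sup>* (W_admissible X, F_admissible X)
      (largest_self_fed X, targets X (largest_self_fed X))
    \<and> \<not> (\<exists>G'. cleaning_step X (largest_self_fed X, targets X (largest_self_fed X)) G')"
    using final by blast
qed

text \<open>
  The edges \<open>a\<close> of a cycle of tandems form a self-fed set, so they survive the cleaning, and with
  them the associated edges.
\<close>
lemma rotation_cycle_iff:
  assumes X: "ranked.settled X"
  shows "rotation_cycle X ts \<longleftrightarrow> ranked.tandem_cycle X ts"
proof
  assume "rotation_cycle X ts"
  then show "ranked.tandem_cycle X ts"
    unfolding rotation_cycle_def ranked.tandem_cycle_def using mem_tandems[OF X] by fastforce
next
  assume ts: "ranked.tandem_cycle X ts"
  let ?A = "fst ` set ts"
  have tan: "p \<in> tandems X" if "p \<in> set ts" for p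
    using ranked.cycle_tandem[OF X ts that] mem_tandems[OF X, of "fst p" "snd p"] by simp
  have tar: "snd p \<in> targets X ?A" if "p \<in> set ts" for p
    using tan[OF that] that by (auto simp: targets_def intro!: bexI[of _ p])
  have "self_fed X ?A"
    unfolding self_fed_def
  proof (intro conjI ballI subsetI)
    fix a assume a: "a \<in> ?A"
    show "a \<in> W_admissible X"
      using ranked.cycle_A[OF X ts a] mem_W_admissible[OF X] by simp
    obtain x where x: "x \<in> X" "outranks x a"
      using ranked.admissibleD[OF ranked.cycle_A[OF X ts a]] by blast
    have "fst x = fst a" using outranks_mem[OF x(2)] by simp
    then have "x \<in> snd ` set ts" using ranked.cycle_replaced[OF X ts a x(1)] by simp
    then show "\<exists>b\<in>targets X ?A. fst b = fst a" using tar \<open>fst x = fst a\<close> by blast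
  qed
  then have sub: "?A \<subseteq> largest_self_fed X" by (auto simp: largest_self_fed_def)
  have "p \<in> tandems X \<and> fst p \<in> fst (active_graph X) \<and> snd p \<in> snd (active_graph X)"
    if p: "p \<in> set ts" for p
  proof -
    have "fst p \<in> largest_self_fed X" using sub p by blast
    moreover have "snd p \<in> targets X (largest_self_fed X)"
      using tar[OF p] targets_mono[OF sub] by blast
    ultimately show ?thesis using tan[OF p] by (simp add: active_graph_eq)
  qed
  then have "\<forall>(a, b)\<in>set ts. (a, b) \<in> tandems X \<and> a \<in> fst (active_graph X)
      \<and> b \<in> snd (active_graph X)"
    by auto
  then show "rotation_cycle X ts"
    using ts unfolding rotation_cycle_def ranked.tandem_cycle_def by simp
qed

section \<open>Routes and ideals of rotations\<close>

lemma rotations_of_eq: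
  assumes "stable X"
  shows "rotations_of X = {ranked.step_label X Y | Y. ranked.covers X Y}"
proof -
  have X: "ranked.settled X" using assms stable_iff_settled by simp
  have lab: "ranked.step_label X ((X - snd ` set ts) \<union> fst ` set ts) = (fst ` set ts, snd ` set ts)"
    if "ranked.tandem_cycle X ts" for ts
    using ranked.cycle_A_notin[OF X that] ranked.cycle_B[OF X that]
    unfolding ranked.step_label_def by blast
  show ?thesis
  proof (intro equalityI subsetI)
    fix R assume "R \<in> rotations_of X"
    then obtain ts where ts: "ranked.tandem_cycle X ts" "R = (fst ` set ts, snd ` set ts)"
      by (auto simp: rotations_of_def rotation_cycle_iff[OF X])
    show "R \<in> {ranked.step_label X Y | Y. ranked.covers X Y}"
      unfolding ts(2) lab[OF ts(1), symmetric] using ranked.tandem_cycle_covers[OF X ts(1)] by blast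
  next
    fix R assume "R \<in> {ranked.step_label X Y | Y. ranked.covers X Y}"
    then obtain Y where Y: "ranked.covers X Y" "R = ranked.step_label X Y" by blast
    then obtain ts where "ranked.tandem_cycle X ts" "Y = (X - snd ` set ts) \<union> fst ` set ts"
      using ranked.covers_iff_tandem_cycle[OF X] by blast
    then have "ranked.tandem_cycle X ts" "R = (fst ` set ts, snd ` set ts)"
      using lab Y(2) by simp_all
    then show "R \<in> rotations_of X"
      by (auto simp: rotations_of_def rotation_cycle_iff[OF X])
  qed
qed

lemma apply_step_label: "apply_rotation (ranked.step_label X Y) X = Y"
  by (auto simp: apply_rotation_def ranked.step_label_def)

lemma route_cover:
  assumes "route X Ls Y" "ranked.covers Y Z"
  shows "route X (Ls @ [ranked.step_label Y Z]) Z"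
proof -
  have "ranked.step_label Y Z \<in> rotations_of Y"
    using assms(2) rotations_of_eq[of Y] ranked.coversD(1) stable_iff_settled by blast
  from route.extend[OF assms(1) this] show ?thesis by (simp add: apply_step_label)
qed

lemma route_induct [consumes 1, case_names start extend]:
  assumes "route X Ls Y"
    and "stable X \<Longrightarrow> P [] X"
    and "\<And>Ls Y Z. route X Ls Y \<Longrightarrow> P Ls Y \<Longrightarrow> stable Y \<Longrightarrow> ranked.covers Y Z
      \<Longrightarrow> P (Ls @ [ranked.step_label Y Z]) Z"
  shows "P Ls Y"
proof -
  have "stable Y \<and> P Ls Y"
    using assms(1)
  proof (induction rule: route.induct)
    case start
    then show ?case using assms(2) by blast
  next
    case (extend Ls Y L)
    then obtain Z where Z: "ranked.covers Y Z" "L = ranked.step_label Y Z"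
      using rotations_of_eq by blast
    then have "apply_rotation L Y = Z" "stable Z"
      using ranked.coversD(2) by (auto simp: apply_step_label stable_iff_settled)
    then show ?case using assms(3)[OF extend.hyps(1) _ _ Z(1)] extend.IH Z(2) by simp
  qed
  then show ?thesis by blast
qed

lemma route_stable: "route X Ls Y \<Longrightarrow> stable X \<and> stable Y"
  by (induction rule: route_induct) (auto simp: stable_iff_settled dest: ranked.coversD(2))

text \<open>
  A covering step adds exactly its own label to \<open>passed\<close>, whence the independence of the route and
  the absence of repetitions.
\<close>
lemma route_passed:
  assumes "route X Ls Y"
  shows "set Ls \<union> ranked.passed X = ranked.passed Y \<and> set Ls \<inter> ranked.passed X = {} \<and> distinct Ls"
  using assms
proof (induction rule: route_induct)
  case (extend Ls Y Z)
  note cover = ranked.passed_cover[OF \<open>ranked.covers Y Z\<close>]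
  then have "ranked.step_label Y Z \<notin> set Ls \<union> ranked.passed X" using extend by simp
  then show ?case using extend cover(1) by auto
qed simp

lemma route_take:
  assumes "route X Ls Y"
  shows "\<exists>Z. route X (take k Ls) Z"
  using assms
proof (induction rule: route_induct)
  case start
  then show ?case using route.start by auto
next
  case (extend Ls Y Z)
  show ?case
  proof (cases "k \<le> length Ls")
    case True
    then show ?thesis using extend.IH by simp
  next
    case False
    then show ?thesis using route_cover[OF extend.hyps(1)] extend.hyps by auto
  qed
qed

lemma route_append:
  assumes "route Y Ms Z" "route X Ls Y"
  shows "route X (Ls @ Ms) Z"
  using assms
proof (induction rule: route_induct)
  case (extend Ms Z Z')
  then show ?case using route_cover[of X "Ls @ Ms" Z Z'] by simp
qed simp

text \<open>
  Among the matchings below \<open>Y\<close> that can be reached, a maximal one must be \<open>Y\<close>, because otherwise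
  a further covering step is possible.
\<close>
lemma route_exists:
  assumes X: "stable X" and Y: "stable Y" and le: "ranked.menu X \<subseteq> ranked.menu Y"
  obtains Ls where "route X Ls Y"
proof -
  let ?P = "\<lambda>Z. (\<exists>Ls. route X Ls Z) \<and> ranked.menu Z \<subseteq> ranked.menu Y"
  have sX: "ranked.settled X" "?P X"
    using X le stable_iff_settled route.start by auto
  obtain Z where Z: "ranked.settled Z" "?P Z"
    and max: "\<And>Z'. ranked.settled Z' \<Longrightarrow> ?P Z' \<Longrightarrow> ranked.menu Z \<subseteq> ranked.menu Z'
      \<Longrightarrow> ranked.menu Z' = ranked.menu Z"
    using ranked.greatest_settled[of X ?P, OF sX] by blast
  have sY: "ranked.settled Y" using Y stable_iff_settled by simp
  have "ranked.menu Z = ranked.menu Y"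
  proof (rule ccontr)
    assume "ranked.menu Z \<noteq> ranked.menu Y"
    then have "ranked.menu Z \<subset> ranked.menu Y" using Z(2) by blast
    from ranked.cover_exists[OF Z(1) sY this]
    obtain Z' where Z': "ranked.covers Z Z'" "ranked.menu Z' \<subseteq> ranked.menu Y" .
    obtain Ls where "route X Ls Z" using Z(2) by blast
    then have "?P Z'" using route_cover Z' by blast
    then have "ranked.menu Z' = ranked.menu Z"
      using max ranked.coversD(2,3)[OF Z'(1)] by blast
    then show False using ranked.coversD(4)[OF Z'(1)] by simp
  qed
  then have "Z = Y" using ranked.menu_inj[OF Z(1) sY] by simp
  then show thesis using Z(2) that by blast
qed

lemma ring_of_stable: "ring_of_sets_order {X. stable X} (\<lambda>X Y. X = Y \<or> prefers_F Y X) ranked.menu"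
proof
  fix X Y assume XY: "X \<in> {X. stable X}" "Y \<in> {X. stable X}"
  then have s: "ranked.settled X" "ranked.settled Y" by (simp_all add: stable_iff_settled)
  show "(X = Y \<or> prefers_F Y X) \<longleftrightarrow> ranked.menu X \<subseteq> ranked.menu Y"
    using prefers_F_iff XY by simp
  show "\<exists>N\<in>{X. stable X}. ranked.menu N = ranked.menu X \<union> ranked.menu Y"
    using ranked.settled_join[OF s] stable_iff_settled by (metis mem_Collect_eq)
  show "\<exists>K\<in>{X. stable X}. ranked.menu K = ranked.menu X \<inter> ranked.menu Y"
    using ranked.settled_meet[OF s] stable_iff_settled by (metis mem_Collect_eq)
next
  show "inj_on ranked.menu {X. stable X}"
    by (rule inj_onI) (simp add: stable_iff_settled ranked.menu_inj)
qed

lemma X_min: "stable X_min" "stable X \<Longrightarrow> ranked.menu X_min \<subseteq> ranked.menu X"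
proof -
  interpret S: ring_of_sets_order "{X. stable X}" "\<lambda>X Y. X = Y \<or> prefers_F Y X" ranked.menu
    by (rule ring_of_stable)
  obtain X0 where "ranked.settled X0" using ranked.settled_exists by blast
  then obtain M where M: "ranked.settled M" "\<And>Z. ranked.settled Z \<Longrightarrow> ranked.menu M \<subseteq> ranked.menu Z"
    using ranked.least_settled[of X0 "\<lambda>_. True"] by auto
  then have "least stable_lattice M (carrier stable_lattice)"
    by (auto simp: least_def stable_lattice_def stable_iff_settled S.below_iff)
  then have "least stable_lattice X_min (carrier stable_lattice)"
    unfolding X_min_def bottom_def by (rule someI)
  then have "stable X_min" "\<forall>X. stable X \<longrightarrow> X_min = X \<or> prefers_F X X_min"
    by (simp_all add: least_def stable_lattice_def)
  then show "stable X_min" "stable X \<Longrightarrow> ranked.menu X_min \<subseteq> ranked.menu X"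
    using prefers_F_iff by blast+
qed

lemma X_max: "stable X_max" "stable X \<Longrightarrow> ranked.menu X \<subseteq> ranked.menu X_max"
proof -
  interpret S: ring_of_sets_order "{X. stable X}" "\<lambda>X Y. X = Y \<or> prefers_F Y X" ranked.menu
    by (rule ring_of_stable)
  obtain X0 where "ranked.settled X0" using ranked.settled_exists by blast
  then obtain M where M: "ranked.settled M"
    "\<And>Z. ranked.settled Z \<Longrightarrow> ranked.menu M \<subseteq> ranked.menu Z \<Longrightarrow> ranked.menu Z = ranked.menu M"
    using ranked.greatest_settled[of X0 "\<lambda>_. True"] by auto
  have "ranked.menu Z \<subseteq> ranked.menu M" if Z: "ranked.settled Z" for Z
  proof -
    obtain N where "ranked.settled N" "ranked.menu N = ranked.menu Z \<union> ranked.menu M"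
      using ranked.settled_join[OF Z M(1)] .
    then show ?thesis using M(2) by blast
  qed
  then have "greatest stable_lattice M (carrier stable_lattice)"
    using M(1) by (auto simp: greatest_def stable_lattice_def stable_iff_settled S.below_iff)
  then have "greatest stable_lattice X_max (carrier stable_lattice)"
    unfolding X_max_def top_def by (rule someI)
  then have "stable X_max" "\<forall>X. stable X \<longrightarrow> X = X_max \<or> prefers_F X_max X"
    by (simp_all add: greatest_def stable_lattice_def)
  then show "stable X_max" "stable X \<Longrightarrow> ranked.menu X \<subseteq> ranked.menu X_max"
    using prefers_F_iff by blast+
qed

lemma passed_X_min: "ranked.passed X_min = {}"
proof -
  have False if L: "L \<in> ranked.labels" "ranked.block L \<subseteq> ranked.menu X_min" for L
  proof -
    obtain X Y where XY: "ranked.covers X Y" "ranked.block L = ranked.menu Y - ranked.menu X"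
      using ranked.labelE[OF L(1)] by blast
    have "ranked.menu X_min \<subseteq> ranked.menu X"
      using X_min(2) ranked.coversD(1)[OF XY(1)] stable_iff_settled by simp
    then show False using L(2) XY(2) ranked.coversD(4)[OF XY(1)] by blast
  qed
  then show ?thesis by (auto simp: ranked.passed_def)
qed

lemma passed_X_max: "ranked.passed X_max = ranked.labels"
proof -
  have "ranked.block L \<subseteq> ranked.menu X_max" if L: "L \<in> ranked.labels" for L
  proof -
    obtain X Y where XY: "ranked.covers X Y" "ranked.block L = ranked.menu Y - ranked.menu X"
      using ranked.labelE[OF L] by blast
    have "ranked.menu Y \<subseteq> ranked.menu X_max"
      using X_max(2) ranked.coversD(2)[OF XY(1)] stable_iff_settled by simp
    then show ?thesis using XY(2) by blast
  qed
  then show ?thesis by (auto simp: ranked.passed_def)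
qed

lemma route_from_X_min: "route X_min Ls X \<Longrightarrow> set Ls = ranked.passed X \<and> distinct Ls"
  using route_passed[of X_min Ls X] passed_X_min by simp

lemma omega_eq: "stable X \<Longrightarrow> omega X = ranked.passed X"
proof -
  assume X: "stable X"
  obtain Ls where "route X_min Ls X" using route_exists[OF X_min(1) X X_min(2)[OF X]] .
  then show ?thesis
    unfolding omega_def by (intro the_equality) (use route_from_X_min in blast)+
qed

lemma all_rotations_eq: "all_rotations = ranked.labels"
proof -
  obtain Ls where "route X_min Ls X_max" using route_exists[OF X_min(1) X_max(1) X_min(2)[OF X_max(1)]] .
  then show ?thesis
    unfolding all_rotations_def
    unfolding passed_X_max[symmetric] by (intro the_equality) (use route_from_X_min in blast)+
qed

text \<open>
  A full route through \<open>X\<close> applies the rotations of \<open>passed X\<close> first.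
\<close>
lemma passed_is_ideal:
  assumes X: "stable X"
  shows "ranked.passed X \<in> rotation_ideals"
proof -
  obtain Ls where Ls: "route X_min Ls X" using route_exists[OF X_min(1) X X_min(2)[OF X]] .
  obtain Ms where Ms: "route X Ms X_max" using route_exists[OF X X_max(1) X_max(2)[OF X]] .
  have full: "route X_min (Ls @ Ms) X_max" using route_append[OF Ms Ls] .
  have "R \<in> ranked.passed X" if R: "rot_less R R'" "R' \<in> ranked.passed X" for R R'
  proof -
    have "R \<in> set (Ls @ Ms)"
      using route_from_X_min[OF full] R(1) by (simp add: rot_less_def all_rotations_eq passed_X_max)
    then obtain i where i: "i < length (Ls @ Ms)" "(Ls @ Ms) ! i = R"
      using in_set_conv_nth by metis
    have "R' \<in> set Ls" using route_from_X_min[OF Ls] R(2) by simp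
    then obtain j where j: "j < length Ls" "Ls ! j = R'" using in_set_conv_nth by metis
    have "j < length (Ls @ Ms)" "(Ls @ Ms) ! j = R'" using j by (simp_all add: nth_append)
    then have "i < j" using R(1) full i unfolding rot_less_def by blast
    then have "R \<in> set Ls" using i j by (auto simp: nth_append)
    then show ?thesis using route_from_X_min[OF Ls] by simp
  qed
  moreover have "ranked.passed X \<subseteq> ranked.labels" by (auto simp: ranked.passed_def)
  ultimately show ?thesis
    unfolding rotation_ideals_def all_rotations_eq by blast
qed

text \<open>
  For \<open>L \<in> I\<close> take the least stable \<open>M\<close> with \<open>L \<in> passed M\<close>. When a full route has just applied \<open>L\<close>, it
  is at a matching above \<open>M\<close> and so has already applied the rest of \<open>passed M\<close>. Hence this rest
  precedes \<open>L\<close> and belongs to \<open>I\<close>.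
\<close>
lemma ideal_is_passed:
  assumes I: "I \<in> rotation_ideals"
  obtains X where "stable X" "ranked.passed X = I"
proof -
  have Il: "I \<subseteq> ranked.labels" using I by (simp add: rotation_ideals_def all_rotations_eq)
  have "\<exists>M. ranked.settled M \<and> L \<in> ranked.passed M \<and> ranked.passed M \<subseteq> I" if L: "L \<in> I" for L
  proof -
    have Ll: "L \<in> ranked.labels" using L Il by blast
    have "L \<in> ranked.passed X_max" using Ll passed_X_max by simp
    then have "ranked.settled X_max" "ranked.block L \<subseteq> ranked.menu X_max"
      using X_max(1) by (simp_all add: stable_iff_settled ranked.passed_def)
    then obtain M where M: "ranked.settled M" "ranked.block L \<subseteq> ranked.menu M"
      and least: "\<And>Z. ranked.settled Z \<Longrightarrow> ranked.block L \<subseteq> ranked.menu Z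
        \<Longrightarrow> ranked.menu M \<subseteq> ranked.menu Z"
      using ranked.least_settled[of X_max "\<lambda>U. ranked.block L \<subseteq> U"] by blast
    have "R \<in> I" if R: "R \<in> ranked.passed M" for R
    proof (cases "R = L")
      case False
      have "i < j" if full: "route X_min Ls X_max" and i: "i < length Ls" "Ls ! i = R"
        and j: "j < length Ls" "Ls ! j = L" for Ls i j
      proof -
        \<comment> \<open>\<open>Z\<close> is the matching right after \<open>L\<close> was applied, hence the prefix of length \<open>Suc j\<close>.\<close>
        obtain Z where Z: "route X_min (take (Suc j) Ls) Z" using route_take[OF full] by blast
        have pZ: "set (take (Suc j) Ls) = ranked.passed Z" using route_from_X_min[OF Z] by simp
        have "L \<in> ranked.passed Z" using pZ j by (auto simp: take_Suc_conv_app_nth)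
        then have "ranked.menu M \<subseteq> ranked.menu Z"
          using least route_stable[OF Z] stable_iff_settled by (simp add: ranked.passed_def)
        then have "R \<in> set (take (Suc j) Ls)" using pZ R ranked.passed_mono by blast
        then obtain k where k: "k < Suc j" "k < length Ls" "Ls ! k = R"
          by (auto simp: in_set_conv_nth)
        have "k = i" using route_from_X_min[OF full] k i by (auto simp: nth_eq_iff_index_eq)
        moreover have "i \<noteq> j" using i j False by blast
        ultimately show "i < j" using k(1) by simp
      qed
      moreover have "R \<in> ranked.labels" using R by (simp add: ranked.passed_def)
      ultimately have "rot_less R L"
        using Ll unfolding rot_less_def all_rotations_eq by blast
      then show ?thesis using I L unfolding rotation_ideals_def by blast
    qed (use L in simp)
    moreover have "L \<in> ranked.passed M" using M(2) Ll by (simp add: ranked.passed_def)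
    ultimately show ?thesis using M(1) by blast
  qed
  moreover have "ranked.settled X_min" using X_min(1) stable_iff_settled by simp
  ultimately obtain X where "ranked.settled X" "ranked.passed X = I"
    using ranked.passed_surj[OF Il _ _ passed_X_min] by blast
  then show thesis using that stable_iff_settled by blast
qed

lemma omega_bij: "bij_betw omega {X. stable X} rotation_ideals"
proof (rule bij_betwI')
  fix X Y assume "X \<in> {X. stable X}" "Y \<in> {X. stable X}"
  then have X: "stable X" and Y: "stable Y" by simp_all
  have s: "ranked.settled X" "ranked.settled Y" using X Y stable_iff_settled by simp_all
  show "omega X = omega Y \<longleftrightarrow> X = Y"
    using ranked.passed_subset_iff[OF s] ranked.passed_subset_iff[OF s(2,1)] ranked.menu_inj[OF s]
    by (auto simp: omega_eq[OF X] omega_eq[OF Y])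
next
  fix X assume "X \<in> {X. stable X}"
  then show "omega X \<in> rotation_ideals" using omega_eq passed_is_ideal by simp
next
  fix I assume "I \<in> rotation_ideals"
  then obtain X where "stable X" "ranked.passed X = I" using ideal_is_passed by blast
  then show "\<exists>X\<in>{X. stable X}. I = omega X" using omega_eq by blast
qed

lemma ring_of_ideals: "ring_of_sets_order rotation_ideals (\<subseteq>) (\<lambda>I. I)"
proof
  fix I J assume "I \<in> rotation_ideals" "J \<in> rotation_ideals"
  then have "I \<union> J \<in> rotation_ideals" "I \<inter> J \<in> rotation_ideals"
    unfolding rotation_ideals_def by blast+
  then show "\<exists>S\<in>rotation_ideals. S = I \<union> J" "\<exists>S\<in>rotation_ideals. S = I \<inter> J" by blast+
qed simp_all

lemma omega_isomorphism: "lattice_isomorphism stable_lattice ideal_lattice omega"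
  unfolding stable_lattice_def ideal_lattice_def
proof (rule ring_of_sets_isomorphism[OF ring_of_stable ring_of_ideals omega_bij])
  fix X Y assume "X \<in> {X. stable X}" "Y \<in> {X. stable X}"
  then have X: "stable X" and Y: "stable Y" by simp_all
  have s: "ranked.settled X" "ranked.settled Y" using X Y stable_iff_settled by simp_all
  show "omega X \<subseteq> omega Y \<longleftrightarrow> ranked.menu X \<subseteq> ranked.menu Y"
    using ranked.passed_subset_iff[OF s] by (simp add: omega_eq[OF X] omega_eq[OF Y])
  fix N assume "N \<in> {X. stable X}"
  then have N: "stable N" by simp
  show "ranked.menu N = ranked.menu X \<union> ranked.menu Y \<Longrightarrow> omega N = omega X \<union> omega Y"
    using ranked.passed_join[OF s] by (simp add: omega_eq[OF X] omega_eq[OF Y] omega_eq[OF N])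
  show "ranked.menu N = ranked.menu X \<inter> ranked.menu Y \<Longrightarrow> omega N = omega X \<inter> omega Y"
    using ranked.passed_meet by (simp add: omega_eq[OF X] omega_eq[OF Y] omega_eq[OF N])
qed

lemma ideal_bounds:
  assumes "I \<in> rotation_ideals" "I' \<in> rotation_ideals"
  shows "is_glb ideal_lattice (I \<inter> I') {I, I'}" "is_lub ideal_lattice (I \<union> I') {I, I'}"
proof -
  interpret ring_of_sets_order rotation_ideals "(\<subseteq>)" "\<lambda>I. I" by (rule ring_of_ideals)
  have "I \<inter> I' \<in> rotation_ideals" "I \<union> I' \<in> rotation_ideals"
    using inter[OF assms] union[OF assms] by auto
  then show "is_glb ideal_lattice (I \<inter> I') {I, I'}" "is_lub ideal_lattice (I \<union> I') {I, I'}"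
    unfolding ideal_lattice_def using is_glbI is_lubI assms by simp_all
qed

end

theorem proposition4p2:
  fixes W :: "'w set" and F :: "'f set" and E :: "('w \<times> 'f) set"
    and pref :: "'w \<Rightarrow> (('w \<times> 'f) \<times> ('w \<times> 'f)) set"
    and CF :: "'f \<Rightarrow> ('w \<times> 'f) set \<Rightarrow> ('w \<times> 'f) set"
  assumes "choice_market W F E pref CF"
  shows "lattice_isomorphism (choice_market.stable_lattice W F E pref CF)
           (choice_market.ideal_lattice W F E pref CF) (choice_market.omega W F E pref CF)
       \<and> (\<forall>I \<in> choice_market.rotation_ideals W F E pref CF.
          \<forall>I' \<in> choice_market.rotation_ideals W F E pref CF.
            is_glb (choice_market.ideal_lattice W F E pref CF) (I \<inter> I') {I, I'}
          \<and> is_lub (choice_market.ideal_lattice W F E pref CF) (I \<union> I') {I, I'})"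
proof -
  interpret choice_market W F E pref CF by fact
  show ?thesis using omega_isomorphism ideal_bounds by blast
qed

end
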